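(* Let $A$ be a bounded linear operator on a Banach space $X$, let $(K_n)_{n=1}^\infty$ be a sequence of compact (in general nonlinear) maps $K_n:X\to X$, and for $x_0\in X$ let $(x_n(x_0))_{n=0}^\infty$ be given by $x_0(x_0)=x_0$ and $$x_{n+1}(x_0)=A\,x_n(x_0)+K_{n+1}(x_n(x_0)),\qquad n\ge0.$$ Let $(a_n)_{n=1}^\infty\subset[0,\infty)$ be a non-increasing sequence with $\lim_{n\to\infty}a_n=0$. Fix $y\in X$, $r>0$, and $n_0\in\mathbb N$ with $a_{n_0}<\frac r2$. Then there exists $x_0\in B(y,r)$ such that $$\|x_n(x_0)\|\ge a_n\,r_e(A)^n,\qquad n\ge n_0.$$
   Context: All Banach spaces are complex and infinite-dimensional; $\mathbb N=\{1,2,\dots\}$. A map $K:X\to X$ is compact if it is continuous and maps bounded sets to precompact sets. $B(y,r)=\{x\in X:\|x-y\|<r\}$. The essential spectrum of $A\in B(X)$ is $\sigma_e(A)=\{\lambda\in\mathbb C:\lambda-A\text{ is not Fredholm}\}$, and $r_e(A)=\max\{|\lambda|:\lambda\in\sigma_e(A)\}$ is the essential spectral radius. *)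

theory Defs
  imports "HOL-Analysis.Analysis"
begin

text \<open>
  Complex normed and Banach spaces extend the real type classes of the library: the real
  structure is the restriction of the complex one.
\<close>

class complex_normed_vector = real_normed_vector +
  fixes scaleC :: "complex \<Rightarrow> 'a \<Rightarrow> 'a" (infixr "*\<^sub>C" 75)
  assumes scaleR_scaleC: "r *\<^sub>R x = complex_of_real r *\<^sub>C x"
    and scaleC_add_right: "c *\<^sub>C (x + y) = c *\<^sub>C x + c *\<^sub>C y"
    and scaleC_add_left: "(c + d) *\<^sub>C x = c *\<^sub>C x + d *\<^sub>C x"
    and scaleC_scaleC: "c *\<^sub>C d *\<^sub>C x = (c * d) *\<^sub>C x"
    and scaleC_one: "1 *\<^sub>C x = x"
    and norm_scaleC: "norm (c *\<^sub>C x) = cmod c * norm x"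

class cbanach = complex_normed_vector + complete_space

subclass (in cbanach) banach ..

global_interpretation complex_vector:
  vector_space "scaleC :: complex \<Rightarrow> 'a \<Rightarrow> 'a::complex_normed_vector"
  by standard (simp_all add: scaleC_add_right scaleC_add_left scaleC_scaleC scaleC_one)

definition finite_cdim :: "'a::complex_normed_vector set \<Rightarrow> bool" where
  "finite_cdim V \<longleftrightarrow> (\<exists>B. finite B \<and> complex_vector.span B = V)"

text \<open>For a subspace \<open>V\<close>: the quotient of the whole space by \<open>V\<close> is spanned by finitely many
  cosets.\<close>

definition finite_ccodim :: "'a::complex_normed_vector set \<Rightarrow> bool" where
  "finite_ccodim V \<longleftrightarrow> (\<exists>F. finite F \<and> complex_vector.span (V \<union> F) = UNIV)"

definition bounded_clinear ::
    "('a::complex_normed_vector \<Rightarrow> 'b::complex_normed_vector) \<Rightarrow> bool" where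
  "bounded_clinear T \<longleftrightarrow> bounded_linear T \<and> (\<forall>c x. T (c *\<^sub>C x) = c *\<^sub>C T x)"

text \<open>On Banach spaces, closedness of the range follows from its finite codimension.\<close>

definition fredholm :: "('a::cbanach \<Rightarrow> 'b::cbanach) \<Rightarrow> bool" where
  "fredholm T \<longleftrightarrow> bounded_clinear T \<and> finite_cdim {x. T x = 0} \<and> finite_ccodim (range T)"

definition essential_spectrum :: "('a::cbanach \<Rightarrow> 'a) \<Rightarrow> complex set" where
  "essential_spectrum A = {\<mu>. \<not> fredholm (\<lambda>x. \<mu> *\<^sub>C x - A x)}"

text \<open>The maximum is written with \<open>GREATEST\<close> because \<open>Max\<close> is meaningful for finite sets only. It
  exists if the space is infinite-dimensional and \<open>A\<close> is a bounded complex-linear operator.\<close>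

definition essential_spectral_radius :: "('a::cbanach \<Rightarrow> 'a) \<Rightarrow> real" where
  "essential_spectral_radius A = (GREATEST \<rho>. \<rho> \<in> cmod ` essential_spectrum A)"

definition compact_map :: "('a::cbanach \<Rightarrow> 'b::cbanach) \<Rightarrow> bool" where
  "compact_map K \<longleftrightarrow>
    continuous_on UNIV K \<and> (\<forall>S. bounded S \<longrightarrow> compact (closure (K ` S)))"

primrec iterates ::
    "('a::cbanach \<Rightarrow> 'a) \<Rightarrow> (nat \<Rightarrow> 'a \<Rightarrow> 'a) \<Rightarrow> 'a \<Rightarrow> nat \<Rightarrow> 'a" where
  "iterates A K x0 0 = x0"
| "iterates A K x0 (Suc n) = A (iterates A K x0 n) + K (Suc n) (iterates A K x0 n)"

end

theory Submission
  imports Defs "HOL-Complex_Analysis.Complex_Analysis"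
begin

text \<open>
  Write \<open>\<rho>\<close> for the essential spectral radius. If \<open>\<rho> = 0\<close>, the point \<open>y\<close> itself will do. Let \<open>\<rho> > 0\<close>, and
  split the orbit as \<open>x\<^sub>n(x) = A\<^sup>n x + G\<^sub>n(x)\<close>. Each \<open>G\<^sub>n\<close> maps the ball to a set with compact closure
  (\<open>iterates_compact_deviation\<close>). Therefore it suffices
  to find \<open>x\<close> in the ball such that \<open>\<parallel>A\<^sup>n x + f\<parallel> \<ge> a\<^sub>n \<rho>\<^sup>n\<close> for all \<open>n \<ge> n\<^sub>0\<close> and \<^emph>\<open>every\<close> \<open>f\<close> in a given
  compact set \<open>C\<^sub>n\<close>.

  The point is \<open>x = y + \<Sum> c\<^sub>k u\<^sub>k\<close>, where the \<open>u\<^sub>k\<close> are unit vectors that are nearly eigenvectors for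
  some \<open>\<mu>\<close> with \<open>\<bar>\<mu>\<bar> = \<rho>\<close> and are nearly annihilated by finitely many prescribed functionals
  (\<open>weakly_small_approximate_eigenvector\<close>). The times \<open>n \<ge> n\<^sub>0\<close> are cut into finite blocks; \<open>u\<^sub>k\<close> serves
  the \<open>k\<close>-th block, on which \<open>a\<^sub>n < c\<^sub>k / 2\<close>. On one block the vectors \<open>w = A\<^sup>n v + f\<close> form a compact set,
  so finitely many functionals almost compute their norms. If \<open>u\<^sub>k\<close> is invisible to these
  functionals, then \<open>\<parallel>w + c\<^sub>k \<mu>\<^sup>n u\<^sub>k\<parallel>\<close> is essentially at least \<open>\<parallel>w\<parallel>\<close>, and it is always at least
  \<open>c\<^sub>k \<rho>\<^sup>n - \<parallel>w\<parallel>\<close>; hence it is essentially at least \<open>c\<^sub>k \<rho>\<^sup>n / 2\<close>, which explains the factor \<open>2\<close> in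
  \<open>a n0 < r / 2\<close>. In the same way finitely many functionals certify the bounds obtained on the block,
  and keeping all later \<open>u\<^sub>j\<close> nearly in their kernels preserves these bounds (\<open>block_step\<close>,
  \<open>block_sequence\<close>).

  For the spectral part, \<open>A\<close> acts on the Banach space of bounded sequences modulo those with totally
  bounded range. A bounded operator on \<open>X\<close> is Fredholm iff it induces an invertible operator there, so
  that the essential spectrum is the ordinary spectrum of the induced operator
  (\<open>essential_spectrum_eq_op_spectrum\<close>). It is therefore compact, and nonempty by Liouville's theorem,
  and each of its points of maximal modulus is an approximate eigenvalue. An
  approximate eigenvector in the quotient is a sequence \<open>x\<^sub>n\<close> that cannot be covered by finitely
  many small balls although the vectors \<open>\<mu> x\<^sub>n - A x\<^sub>n\<close> can; normalised differences of suitable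
  members of this sequence are the vectors \<open>u\<^sub>k\<close>.
\<close>

section \<open>Norming functionals\<close>

text \<open>
  The norm bound is part of the notion because it gives all these functions the common lower
  bound \<open>- norm x\<close>, so that infima over families of them exist.
\<close>

definition sublinear :: "('a::real_normed_vector \<Rightarrow> real) \<Rightarrow> bool" where
  "sublinear q \<longleftrightarrow> (\<forall>x y. q (x + y) \<le> q x + q y) \<and> (\<forall>x. \<forall>t>0. q (t *\<^sub>R x) \<le> t * q x)
     \<and> (\<forall>x. q x \<le> norm x)"

lemma sublinear_zero: "q 0 = 0" if "sublinear q"
proof -
  have "q (0 + 0) \<le> q 0 + q 0"
    using that unfolding sublinear_def by blast
  moreover have "0 < (1/2 :: real) \<longrightarrow> q ((1/2) *\<^sub>R 0) \<le> (1/2) * q 0"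
    using that unfolding sublinear_def by blast
  ultimately have "q 0 \<ge> 0" "q 0 \<le> (1/2) * q 0" by auto
  then show ?thesis by simp
qed

lemma sublinear_lower_bound: "- norm x \<le> q x" if "sublinear q"
proof -
  have "q (x + - x) \<le> q x + q (- x)" "q (- x) \<le> norm (- x)"
    using that unfolding sublinear_def by blast+
  then show ?thesis using sublinear_zero[OF that] by simp
qed

text \<open>
  The function \<open>p x = inf (q (x + t a) - t q a)\<close> over \<open>t \<ge> 0\<close> pushes \<open>q\<close> down towards a function that is
  linear in the direction \<open>a\<close>: \<open>t = 1\<close> gives the bound at \<open>- a\<close>. A minimal sublinear function therefore
  is odd, hence linear, and the Hahn-Banach theorem follows without extending functionals from
  subspaces.
\<close>

lemma sublinear_lowering:
  fixes q :: "'a::real_normed_vector \<Rightarrow> real"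
  assumes q: "sublinear q"
  obtains p where "sublinear p" "p \<le> q" "p (- a) \<le> - q a"
proof -
  have sub: "q (x + y) \<le> q x + q y" for x y
    using q unfolding sublinear_def by blast
  have hom: "q (t *\<^sub>R x) \<le> t * q x" if "t > 0" for t x
    using q that unfolding sublinear_def by blast
  have hom': "q (t *\<^sub>R x) = t * q x" if "t \<ge> 0" for t x
  proof (cases "t = 0")
    case False
    have "q ((1 / t) *\<^sub>R (t *\<^sub>R x)) \<le> (1 / t) * q (t *\<^sub>R x)"
      using that False by (intro hom) auto
    then have "t * q x \<le> q (t *\<^sub>R x)" using that False by (simp add: field_simps)
    with hom[of t x] that False show ?thesis by simp
  qed (use sublinear_zero[OF q] in simp)
  define p where "p x = (INF t\<in>{0..}. q (x + t *\<^sub>R a) - t * q a)" for x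
  have low: "- norm x \<le> q (x + t *\<^sub>R a) - t * q a" if "t \<ge> 0" for t x
  proof -
    have "q (t *\<^sub>R a) \<le> q (x + t *\<^sub>R a) + q (- x)"
      using sub[of "x + t *\<^sub>R a" "- x"] by simp
    moreover have "q (- x) \<le> norm x" using q unfolding sublinear_def
      by (metis norm_minus_cancel)
    ultimately show ?thesis using hom'[OF that] by simp
  qed
  have bdd: "bdd_below ((\<lambda>t. q (x + t *\<^sub>R a) - t * q a) ` {0..})" for x
    using low[of _ x] by (intro bdd_belowI2) auto
  have p_le: "p x \<le> q (x + t *\<^sub>R a) - t * q a" if "t \<ge> 0" for t x
    unfolding p_def using that by (intro cINF_lower bdd) auto
  have p_ge: "c \<le> p x" if "\<And>t. t \<ge> 0 \<Longrightarrow> c \<le> q (x + t *\<^sub>R a) - t * q a" for c x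
    unfolding p_def using that by (intro cINF_greatest) auto
  have pq: "p x \<le> q x" for x using p_le[of 0 x] by simp
  have add: "p (x + y) \<le> p x + p y" for x y
  proof -
    have "p (x + y) - p y \<le> q (x + s *\<^sub>R a) - s * q a" if s: "s \<ge> 0" for s
    proof -
      have "p (x + y) - (q (x + s *\<^sub>R a) - s * q a) \<le> q (y + t *\<^sub>R a) - t * q a" if t: "t \<ge> 0" for t
      proof -
        have "p (x + y) \<le> q (x + y + (s + t) *\<^sub>R a) - (s + t) * q a"
          using s t by (intro p_le) auto
        moreover have "q (x + y + (s + t) *\<^sub>R a) \<le> q (x + s *\<^sub>R a) + q (y + t *\<^sub>R a)"
          using sub[of "x + s *\<^sub>R a" "y + t *\<^sub>R a"] by (simp add: algebra_simps)
        ultimately show ?thesis by (simp add: algebra_simps)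
      qed
      from p_ge[OF this] show ?thesis by simp
    qed
    from p_ge[OF this] show ?thesis by simp
  qed
  have scale: "p (t *\<^sub>R x) \<le> t * p x" if t: "t > 0" for t x
  proof -
    have "p (t *\<^sub>R x) / t \<le> q (x + s *\<^sub>R a) - s * q a" if s: "s \<ge> 0" for s
    proof -
      have "p (t *\<^sub>R x) \<le> q (t *\<^sub>R x + (t * s) *\<^sub>R a) - (t * s) * q a"
        using s t by (intro p_le) auto
      also have "q (t *\<^sub>R x + (t * s) *\<^sub>R a) = t * q (x + s *\<^sub>R a)"
        using hom'[of t "x + s *\<^sub>R a"] t by (simp add: algebra_simps)
      finally show ?thesis using t by (simp add: field_simps)
    qed
    from p_ge[OF this] show ?thesis using t by (simp add: field_simps)
  qed
  have "sublinear p"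
    unfolding sublinear_def using add scale pq q[unfolded sublinear_def] order_trans by blast
  moreover have "p (- a) \<le> - q a"
    using p_le[of 1 "- a"] sublinear_zero[OF q] by simp
  ultimately show thesis using that pq by (auto simp: le_fun_def)
qed

text \<open>
  The pointwise infimum works; it is subadditive because two members of a chain have a smaller
  one among them.
\<close>

lemma sublinear_chain_lower_bound:
  fixes C :: "('a::real_normed_vector \<Rightarrow> real) set"
  assumes "C \<noteq> {}" and sub: "\<And>q. q \<in> C \<Longrightarrow> sublinear q"
    and chain: "\<And>p q. p \<in> C \<Longrightarrow> q \<in> C \<Longrightarrow> p \<le> q \<or> q \<le> p"
  obtains p where "sublinear p" "\<And>q. q \<in> C \<Longrightarrow> p \<le> q"
proof -
  define p where "p x = (INF q\<in>C. q x)" for x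
  have bdd: "bdd_below ((\<lambda>q. q x) ` C)" for x
    using sublinear_lower_bound[OF sub] by (intro bdd_belowI2[of _ "- norm x"]) auto
  have p_le: "p x \<le> q x" if "q \<in> C" for q x
    unfolding p_def using that by (intro cINF_lower bdd)
  have p_ge: "c \<le> p x" if "\<And>q. q \<in> C \<Longrightarrow> c \<le> q x" for c x
    unfolding p_def using that assms(1) by (intro cINF_greatest) auto
  have add: "p (x + y) \<le> p x + p y" for x y
  proof -
    have "p (x + y) - p y \<le> q x" if q: "q \<in> C" for q
    proof -
      have "p (x + y) - q x \<le> q' y" if q': "q' \<in> C" for q'
      proof -
        obtain s where s: "s \<in> C" "s \<le> q" "s \<le> q'" using chain[OF q q'] q q' by blast
        have "p (x + y) \<le> s (x + y)" using s by (intro p_le)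
        also have "\<dots> \<le> s x + s y" using sub[OF s(1)] unfolding sublinear_def by blast
        also have "\<dots> \<le> q x + q' y" using s by (intro add_mono) (auto simp: le_fun_def)
        finally show ?thesis by simp
      qed
      then have "p (x + y) - q x \<le> p y" by (intro p_ge)
      then show ?thesis by simp
    qed
    then have "p (x + y) - p y \<le> p x" by (intro p_ge)
      then show ?thesis by simp
  qed
  have scale: "p (t *\<^sub>R x) \<le> t * p x" if t: "t > 0" for t x
  proof -
    have "p (t *\<^sub>R x) / t \<le> q x" if "q \<in> C" for q
    proof -
      have "p (t *\<^sub>R x) \<le> t * q x"
        using p_le[OF that] sub[OF that] t unfolding sublinear_def by (meson order_trans)
      then show ?thesis using t by (simp add: field_simps)
    qed
    then have "p (t *\<^sub>R x) / t \<le> p x" by (intro p_ge)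
    then show ?thesis using t by (simp add: field_simps)
  qed
  have "p x \<le> norm x" for x
    using assms(1) p_le sub unfolding sublinear_def by (meson ex_in_conv order_trans)
  then have "sublinear p" using add scale unfolding sublinear_def by blast
  then show thesis using that p_le by (auto simp: le_fun_def)
qed

text \<open>
  Lowering the norm in the direction \<open>w\<close> first forces \<open>q (- w) \<le> - norm w\<close>, a condition inherited by
  smaller functions. A minimal function below (Zorn's lemma) is linear and takes the value \<open>norm w\<close>
  at \<open>w\<close>.
\<close>

theorem norming_functional:
  fixes w :: "'a::real_normed_vector"
  obtains f :: "'a \<Rightarrow> real" where "bounded_linear f" "\<And>x. \<bar>f x\<bar> \<le> norm x" "f w = norm w"
proof -
  define S where "S = {q :: 'a \<Rightarrow> real. sublinear q \<and> q (- w) \<le> - norm w}"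
  define R where "R = relation_of (\<lambda>q p :: 'a \<Rightarrow> real. p \<le> q) S"
  have "sublinear (norm :: 'a \<Rightarrow> real)"
    unfolding sublinear_def by (auto simp: norm_triangle_ineq)
  then obtain p0 where p0: "p0 \<in> S"
    using sublinear_lowering[of norm w] unfolding S_def by blast
  have "partial_order_on S R"
    unfolding R_def by (intro partial_order_on_relation_ofI) auto
  moreover have "\<exists>u\<in>S. \<forall>q\<in>C. u \<le> q" if C: "C \<in> Chains R" for C
  proof (cases "C = {}")
    case False
    have CS: "C \<subseteq> S" using C unfolding Chains_def R_def relation_of_def by auto
    have "p \<le> q \<or> q \<le> p" if "p \<in> C" "q \<in> C" for p q
      using C that unfolding Chains_def R_def relation_of_def by auto
    then obtain u where u: "sublinear u" "\<And>q. q \<in> C \<Longrightarrow> u \<le> q"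
      using sublinear_chain_lower_bound[OF False] CS unfolding S_def by blast
    obtain q where "q \<in> C" using False by blast
    then have "u (- w) \<le> - norm w"
      using u(2)[of q] CS unfolding S_def le_fun_def by (auto intro: order_trans)
    then show ?thesis using u unfolding S_def by blast
  qed (use p0 in blast)
  ultimately obtain m where m: "m \<in> S" "\<And>q. q \<in> S \<Longrightarrow> q \<le> m \<Longrightarrow> q = m"
    using predicate_Zorn[of S "\<lambda>q p. p \<le> q"] unfolding R_def by blast
  have msub: "sublinear m" and mw: "m (- w) \<le> - norm w" using m(1) unfolding S_def by auto
  have add: "m (x + y) \<le> m x + m y" for x y using msub unfolding sublinear_def by blast
  have odd: "m (- a) = - m a" for a
  proof -
    obtain p where p: "sublinear p" "p \<le> m" "p (- a) \<le> - m a"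
      using sublinear_lowering[OF msub] by blast
    have "p (- w) \<le> - norm w" using p(2) mw by (meson le_funD order_trans)
    then have "p = m" using p m(2) unfolding S_def by blast
    then have "m (- a) \<le> - m a" using p(3) by simp
    moreover have "0 \<le> m a + m (- a)" using add[of a "- a"] sublinear_zero[OF msub] by simp
    ultimately show ?thesis by simp
  qed
  have add_eq: "m (x + y) = m x + m y" for x y
    using add[of x y] add[of "- x" "- y"] odd[of "x + y"] odd[of x] odd[of y] by simp
  have bound: "\<bar>m x\<bar> \<le> norm x" for x
    using msub sublinear_lower_bound[OF msub, of x] unfolding sublinear_def by (auto simp: abs_le_iff)
  have pos: "m (t *\<^sub>R x) = t * m x" if "t > 0" for t x
  proof -
    have le: "m (t *\<^sub>R x) \<le> t * m x" for x using msub that unfolding sublinear_def by blast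
    from le[of x] le[of "- x"] show ?thesis by (simp add: odd)
  qed
  have scale: "m (t *\<^sub>R x) = t * m x" for t x
  proof (cases t "0 :: real" rule: linorder_cases)
    case less
    then have "m ((- t) *\<^sub>R x) = (- t) * m x" by (intro pos) auto
    then show ?thesis by (simp add: odd)
  qed (use pos sublinear_zero[OF msub] in auto)
  have "bounded_linear m"
    by (rule bounded_linear_intro[where K=1]) (use add_eq scale bound in auto)
  moreover have "m w = norm w" using mw odd[of w] bound[of w] by simp
  ultimately show thesis using that bound by blast
qed

section \<open>Bounded sequences modulo totally bounded sequences\<close>

text \<open>
  The infimum of these \<open>r\<close> is the ball measure of noncompactness of the range of \<open>x\<close>.
\<close>

definition covered :: "real \<Rightarrow> (nat \<Rightarrow> 'a::real_normed_vector) \<Rightarrow> bool" where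
  "covered r x \<longleftrightarrow> (\<exists>F. finite F \<and> (\<forall>n. \<exists>f\<in>F. norm (x n - f) \<le> r))"

lemma coveredI: "finite F \<Longrightarrow> (\<And>n. \<exists>f\<in>F. norm (x n - f) \<le> r) \<Longrightarrow> covered r x"
  by (auto simp: covered_def)

lemma covered_mono:
  assumes "covered r x" "r \<le> s"
  shows "covered s x"
proof -
  obtain F where F: "finite F" "\<forall>n. \<exists>f\<in>F. norm (x n - f) \<le> r"
    using assms(1) unfolding covered_def by auto
  show ?thesis
  proof (rule coveredI[OF F(1)])
    fix n
    obtain f where "f \<in> F" "norm (x n - f) \<le> r" using F(2) by auto
    then show "\<exists>f\<in>F. norm (x n - f) \<le> s" using assms(2) by (intro bexI[of _ f]) auto
  qed
qed

lemma covered_nonneg: "0 \<le> r" if r: "covered r x"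
proof -
  obtain f where "norm (x 0 - f) \<le> r" using r unfolding covered_def by auto
  then show ?thesis using norm_ge_zero[of "x 0 - f"] by linarith
qed

lemma covered_bounded: "covered r x" if "\<And>n. norm (x n) \<le> r"
  using that by (intro coveredI[of "{0}"]) auto

lemma covered_const: "covered 0 (\<lambda>_. c)"
  by (intro coveredI[of "{c}"]) auto

lemma covered_add:
  assumes "covered r x" "covered s y"
  shows "covered (r + s) (\<lambda>n. x n + y n)"
proof -
  obtain F where F: "finite F" "\<forall>n. \<exists>f\<in>F. norm (x n - f) \<le> r"
    using assms(1) unfolding covered_def by auto
  obtain G where G: "finite G" "\<forall>n. \<exists>g\<in>G. norm (y n - g) \<le> s"
    using assms(2) unfolding covered_def by auto
  show ?thesis
  proof (rule coveredI)
    show "finite ((\<lambda>(f, g). f + g) ` (F \<times> G))" using F(1) G(1) by blast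
    fix n
    obtain f where f: "f \<in> F" "norm (x n - f) \<le> r" using F(2) by auto
    obtain g where g: "g \<in> G" "norm (y n - g) \<le> s" using G(2) by auto
    have "norm ((x n - f) + (y n - g)) \<le> r + s"
      using norm_triangle_mono[OF f(2) g(2)] .
    moreover have "f + g \<in> (\<lambda>(f, g). f + g) ` (F \<times> G)" using f(1) g(1) by auto
    ultimately show "\<exists>h\<in>(\<lambda>(f, g). f + g) ` (F \<times> G). norm (x n + y n - h) \<le> r + s"
      by (intro bexI[of _ "f + g"]) (auto simp: algebra_simps)
  qed
qed

lemma covered_image:
  assumes "covered r x" and lip: "\<And>u v. norm (g u - g v) \<le> c * norm (u - v)" and "0 \<le> c"
  shows "covered (c * r) (\<lambda>n. g (x n))"
proof -
  obtain F where F: "finite F" "\<forall>n. \<exists>f\<in>F. norm (x n - f) \<le> r"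
    using assms(1) unfolding covered_def by auto
  show ?thesis
  proof (rule coveredI)
    show "finite (g ` F)" using F(1) by blast
    fix n
    obtain f where f: "f \<in> F" "norm (x n - f) \<le> r" using F(2) by auto
    have "norm (g (x n) - g f) \<le> c * r"
      using lip[of "x n" f] mult_left_mono[OF f(2) assms(3)] by linarith
    then show "\<exists>h\<in>g ` F. norm (g (x n) - h) \<le> c * r" using f(1) by blast
  qed
qed

lemma covered_uminus: "covered r (\<lambda>n. - x n)" if "covered r x"
  using covered_image[OF that, of uminus 1] by (simp add: norm_minus_commute)

lemma covered_diff: "covered (r + s) (\<lambda>n. x n - y n)" if "covered r x" "covered s y"
  using covered_add[OF that(1) covered_uminus[OF that(2)]] by simp

lemma covered_linear:
  assumes "bounded_linear T"
  obtains K where "K > 0" "\<And>r x. covered r x \<Longrightarrow> covered (K * r) (\<lambda>n. T (x n))"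
proof -
  obtain K where K: "K > 0" "\<And>x. norm (T x) \<le> norm x * K"
    using bounded_linear.pos_bounded[OF assms] by auto
  have "norm (T u - T v) \<le> K * norm (u - v)" for u v
    using K(2)[of "u - v"] by (simp add: linear_diff[OF bounded_linear.linear[OF assms]] mult.commute)
  then show thesis using K(1) covered_image[of _ _ T K] that[of K] by simp
qed

text \<open>
  Total boundedness of the range, stated through \<open>covered\<close> so that the norm of the quotient
  vanishes on these sequences by definition.
\<close>

definition totally_bounded_seq :: "(nat \<Rightarrow> 'a::real_normed_vector) \<Rightarrow> bool" where
  "totally_bounded_seq x \<longleftrightarrow> (\<forall>r>0. covered r x)"

lemma totally_bounded_seq_linear:
  assumes "bounded_linear T" and x: "totally_bounded_seq x"
  shows "totally_bounded_seq (\<lambda>n. T (x n))"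
proof -
  obtain K where K: "K > 0" "\<And>r x. covered r x \<Longrightarrow> covered (K * r) (\<lambda>n. T (x n))"
    using covered_linear[OF assms(1)] by blast
  have "covered r (\<lambda>n. T (x n))" if "r > 0" for r
    using K(2)[of "r / K" x] K(1) x that by (simp add: totally_bounded_seq_def)
  then show ?thesis by (simp add: totally_bounded_seq_def)
qed

lemma totally_bounded_seq_const: "totally_bounded_seq (\<lambda>_. c)"
  unfolding totally_bounded_seq_def by (auto intro: covered_mono[OF covered_const])

lemma totally_bounded_seq_add: "totally_bounded_seq (\<lambda>n. x n + y n)" if "totally_bounded_seq x" "totally_bounded_seq y"
  unfolding totally_bounded_seq_def
proof (intro allI impI)
  fix r :: real assume "r > 0"
  then show "covered r (\<lambda>n. x n + y n)"
    using covered_add[of "r/2" x "r/2" y] that by (simp add: totally_bounded_seq_def)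
qed

lemma totally_bounded_seq_uminus: "totally_bounded_seq (\<lambda>n. - x n)" if "totally_bounded_seq x"
  using that by (simp add: totally_bounded_seq_def covered_uminus)

text \<open>
  Boundedness of the range (see \<open>bounded_seq_iff_bounded\<close>), stated through \<open>covered\<close> so that the
  algebraic properties of \<open>covered\<close> carry over.
\<close>

definition bounded_seq :: "(nat \<Rightarrow> 'a::real_normed_vector) \<Rightarrow> bool" where
  "bounded_seq x \<longleftrightarrow> (\<exists>r. covered r x)"

lemma bounded_seqE:
  assumes "bounded_seq x" obtains r where "covered r x"
  using assms by (auto simp: bounded_seq_def)

lemma bounded_seq_add: "bounded_seq x \<Longrightarrow> bounded_seq y \<Longrightarrow> bounded_seq (\<lambda>n. x n + y n)"
  unfolding bounded_seq_def using covered_add by blast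

lemma bounded_seq_linear:
  assumes "bounded_linear T" "bounded_seq x"
  shows "bounded_seq (\<lambda>n. T (x n))"
proof -
  obtain K where K: "K > 0" "\<And>r x. covered r x \<Longrightarrow> covered (K * r) (\<lambda>n. T (x n))"
    using covered_linear[OF assms(1)] by blast
  obtain r where "covered r x" using assms(2) by (rule bounded_seqE)
  then have "covered (K * r) (\<lambda>n. T (x n))" by (rule K(2))
  then show ?thesis by (auto simp: bounded_seq_def)
qed

lemma bounded_seq_uminus: "bounded_seq x \<Longrightarrow> bounded_seq (\<lambda>n. - x n)"
  unfolding bounded_seq_def using covered_uminus by blast

lemma bounded_seq_diff: "bounded_seq x \<Longrightarrow> bounded_seq y \<Longrightarrow> bounded_seq (\<lambda>n. x n - y n)"
  unfolding bounded_seq_def using covered_diff by blast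

lemma bounded_seqI: "(\<And>n. norm (x n) \<le> r) \<Longrightarrow> bounded_seq x"
  unfolding bounded_seq_def using covered_bounded by blast

lemma bounded_seq_iff_bounded: "bounded_seq x \<longleftrightarrow> (\<exists>B. \<forall>n. norm (x n) \<le> B)"
proof
  assume "bounded_seq x"
  then obtain r where "covered r x" by (rule bounded_seqE)
  then obtain F where F: "finite F" "\<forall>n. \<exists>f\<in>F. norm (x n - f) \<le> r" unfolding covered_def by auto 
  have "norm (x n) \<le> r + (\<Sum>f\<in>F. norm f)" for n
  proof -
    obtain f where f: "f \<in> F" "norm (x n - f) \<le> r" using F(2) by auto
    have "norm f \<le> (\<Sum>f\<in>F. norm f)" using f(1) F(1) by (intro member_le_sum) auto
    then show ?thesis using f(2) norm_triangle_sub[of "x n" f] by linarith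
  qed
  then show "\<exists>B. \<forall>n. norm (x n) \<le> B" by blast
qed (use bounded_seqI in blast)

definition ess_rel :: "(nat \<Rightarrow> 'a::real_normed_vector) \<Rightarrow> (nat \<Rightarrow> 'a) \<Rightarrow> bool" where
  "ess_rel x y \<longleftrightarrow> bounded_seq x \<and> bounded_seq y \<and> totally_bounded_seq (\<lambda>n. x n - y n)"

lemma ess_rel_refl_iff: "ess_rel x x \<longleftrightarrow> bounded_seq x"
  by (simp add: ess_rel_def totally_bounded_seq_const)

lemma ess_rel_sym: "ess_rel y x" if "ess_rel x y"
  using that totally_bounded_seq_uminus[of "\<lambda>n. x n - y n"] by (simp add: ess_rel_def)

lemma ess_rel_trans: "ess_rel x z" if "ess_rel x y" "ess_rel y z"
  using that totally_bounded_seq_add[of "\<lambda>n. x n - y n" "\<lambda>n. y n - z n"] by (simp add: ess_rel_def)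

lemma part_equivp_ess_rel:
  "part_equivp (ess_rel :: (nat \<Rightarrow> 'a::real_normed_vector) \<Rightarrow> (nat \<Rightarrow> 'a) \<Rightarrow> bool)"
proof (rule part_equivpI)
  have "ess_rel (\<lambda>_. 0 :: 'a) (\<lambda>_. 0)"
    unfolding ess_rel_refl_iff bounded_seq_def using covered_const by blast
  then show "\<exists>x :: nat \<Rightarrow> 'a. ess_rel x x" by blast
  show "symp (ess_rel :: (nat \<Rightarrow> 'a) \<Rightarrow> _)" by (rule sympI) (rule ess_rel_sym)
  show "transp (ess_rel :: (nat \<Rightarrow> 'a) \<Rightarrow> _)" by (rule transpI) (rule ess_rel_trans)
qed

text \<open>
  The quotient of the bounded sequences by those with totally bounded range. Measuring a class by
  its covering radius gives a normed space, which is complete if the given space is; an operator acts on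
  it modulo whatever is compact.
\<close>

quotient_type (overloaded) 'a ess = "nat \<Rightarrow> 'a::complex_normed_vector" / partial: ess_rel
  by (rule part_equivp_ess_rel)

definition covering_radius :: "(nat \<Rightarrow> 'a::real_normed_vector) \<Rightarrow> real" where
  "covering_radius x = Inf {r. covered r x}"

lemma covering_radius_le: "covering_radius x \<le> r" if "covered r x"
  unfolding covering_radius_def using that covered_nonneg
  by (intro cInf_lower bdd_belowI[of _ 0]) auto

lemma covered_if_covering_radius_less:
  assumes "bounded_seq x" "covering_radius x < s"
  shows "covered s x"
proof -
  have "{t. covered t x} \<noteq> {}" using assms(1) by (auto simp: bounded_seq_def)
  then obtain t where "covered t x" "t < s"
    using cInf_lessD[of "{t. covered t x}" s] assms(2) by (auto simp: covering_radius_def)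
  then show ?thesis using covered_mono[of t x s] by simp
qed

lemma covering_radius_nonneg: "0 \<le> covering_radius x" if "bounded_seq x"
  unfolding covering_radius_def using that covered_nonneg
  by (intro cInf_greatest) (auto simp: bounded_seq_def)

lemma covering_radius_zero_iff: "covering_radius x = 0 \<longleftrightarrow> totally_bounded_seq x" if "bounded_seq x"
proof
  assume "covering_radius x = 0" then show "totally_bounded_seq x"
    using covered_if_covering_radius_less[OF that] by (simp add: totally_bounded_seq_def)
next
  assume "totally_bounded_seq x"
  then have "covering_radius x \<le> 0 + e" if "e > 0" for e
    using covering_radius_le[of e x] that by (simp add: totally_bounded_seq_def)
  then have "covering_radius x \<le> 0" by (rule field_le_epsilon)
  then show "covering_radius x = 0" using covering_radius_nonneg[OF that] by simp
qed

lemma covering_radius_add: "covering_radius (\<lambda>n. x n + y n) \<le> covering_radius x + covering_radius y"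
  if "bounded_seq x" "bounded_seq y"
proof (rule field_le_epsilon)
  fix e :: real assume "e > 0"
  then have "covered (covering_radius x + e/2) x" "covered (covering_radius y + e/2) y"
    by (auto intro!: covered_if_covering_radius_less that)
  then have "covered ((covering_radius x + e/2) + (covering_radius y + e/2)) (\<lambda>n. x n + y n)"
    by (rule covered_add)
  from covering_radius_le[OF this]
  show "covering_radius (\<lambda>n. x n + y n) \<le> covering_radius x + covering_radius y + e" by simp
qed

lemma covering_radius_image_le:
  assumes "bounded_seq x" "c > 0" "\<And>u v. norm (g u - g v) \<le> c * norm (u - v)"
  shows "covering_radius (\<lambda>n. g (x n)) \<le> c * covering_radius x"
proof (rule field_le_epsilon)
  fix e :: real assume "e > 0"
  then have "covered (covering_radius x + e / c) x"
    using assms(1,2) by (intro covered_if_covering_radius_less) auto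
  then have "covered (c * (covering_radius x + e / c)) (\<lambda>n. g (x n))"
    using assms(2,3) by (intro covered_image) auto
  from covering_radius_le[OF this]
  show "covering_radius (\<lambda>n. g (x n)) \<le> c * covering_radius x + e"
    using assms(2) by (simp add: algebra_simps)
qed

lemma bounded_linear_scaleC: "bounded_linear (\<lambda>x :: 'a::complex_normed_vector. c *\<^sub>C x)"
  by (rule bounded_linear_intro[where K="cmod c"])
    (auto simp: scaleC_add_right scaleR_scaleC scaleC_scaleC norm_scaleC mult.commute)

lemma norm_scaleC_diff: "norm (c *\<^sub>C u - c *\<^sub>C v) = cmod c * norm (u - v)"
  for u v :: "'a::complex_normed_vector"
  using norm_scaleC[of c "u - v"] by (simp add: complex_vector.scale_right_diff_distrib)

lemma covering_radius_scaleC: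
  fixes x :: "nat \<Rightarrow> 'a::complex_normed_vector"
  assumes x: "bounded_seq x"
  shows "covering_radius (\<lambda>n. c *\<^sub>C x n) = cmod c * covering_radius x"
proof (cases "c = 0")
  case True
  have "bounded_seq (\<lambda>_. 0 :: 'a)" using bounded_seqI[of "\<lambda>_. 0 :: 'a" 0] by simp
  then show ?thesis using True totally_bounded_seq_const[of "0 :: 'a"] by (simp add: covering_radius_zero_iff)
next
  case False
  have le: "covering_radius (\<lambda>n. d *\<^sub>C z n) \<le> cmod d * covering_radius z"
    if "d \<noteq> 0" "bounded_seq z" for d and z :: "nat \<Rightarrow> 'a"
    using that by (intro covering_radius_image_le) (auto simp: norm_scaleC_diff)
  have "covering_radius (\<lambda>n. inverse c *\<^sub>C c *\<^sub>C x n)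
      \<le> cmod (inverse c) * covering_radius (\<lambda>n. c *\<^sub>C x n)"
    using False by (intro le bounded_seq_linear[OF bounded_linear_scaleC] x) auto
  then have "covering_radius x \<le> inverse (cmod c) * covering_radius (\<lambda>n. c *\<^sub>C x n)"
    using False by (simp add: norm_inverse)
  then have "cmod c * covering_radius x \<le> covering_radius (\<lambda>n. c *\<^sub>C x n)"
    using False by (simp add: field_simps)
  then show ?thesis using le[OF False x] by simp
qed

lemma covering_radius_cong: "covering_radius x = covering_radius y" if "ess_rel x y"
proof -
  have le: "covering_radius x \<le> covering_radius y" if xy: "ess_rel x y" for x y :: "nat \<Rightarrow> 'a"
  proof -
    have d: "bounded_seq (\<lambda>n. x n - y n)" using xy by (simp add: ess_rel_def bounded_seq_diff)
    have "covering_radius (\<lambda>n. (x n - y n) + y n) \<le> covering_radius (\<lambda>n. x n - y n) + covering_radius y"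
      using d xy by (intro covering_radius_add) (auto simp: ess_rel_def)
    moreover have "covering_radius (\<lambda>n. x n - y n) = 0"
      unfolding covering_radius_zero_iff[OF d] using xy by (simp add: ess_rel_def)
    ultimately show ?thesis by simp
  qed
  show ?thesis
    using le[OF that] le[OF ess_rel_sym[OF that]] by simp
qed

lemma ess_rel_linear: "ess_rel (\<lambda>n. T (x n)) (\<lambda>n. T (y n))" if "bounded_linear T" "ess_rel x y"
  using that totally_bounded_seq_linear[OF that(1), of "\<lambda>n. x n - y n"] bounded_seq_linear[OF that(1)]
  by (simp add: ess_rel_def linear_diff[OF bounded_linear.linear[OF that(1)]])

lemma ess_rel_add: "ess_rel (\<lambda>n. x n + y n) (\<lambda>n. x' n + y' n)" if "ess_rel x x'" "ess_rel y y'"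
  using that totally_bounded_seq_add[of "\<lambda>n. x n - x' n" "\<lambda>n. y n - y' n"]
  by (simp add: ess_rel_def bounded_seq_add add_diff_add)

instantiation ess :: (complex_normed_vector) "{real_vector, norm}"
begin

lift_definition zero_ess :: "'a ess" is "\<lambda>_. 0"
  unfolding ess_rel_refl_iff by (rule bounded_seqI[of _ 0]) simp

lift_definition plus_ess :: "'a ess \<Rightarrow> 'a ess \<Rightarrow> 'a ess" is "\<lambda>x y n. x n + y n"
  by (rule ess_rel_add)

lift_definition uminus_ess :: "'a ess \<Rightarrow> 'a ess" is "\<lambda>x n. - x n"
  using ess_rel_linear[OF bounded_linear_minus[OF bounded_linear_ident]] .

lift_definition scaleR_ess :: "real \<Rightarrow> 'a ess \<Rightarrow> 'a ess" is "\<lambda>c x n. c *\<^sub>R x n"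
  using ess_rel_linear[OF bounded_linear_scaleR_right] .

lift_definition norm_ess :: "'a ess \<Rightarrow> real" is covering_radius
  by (rule covering_radius_cong)

definition minus_ess :: "'a ess \<Rightarrow> 'a ess \<Rightarrow> 'a ess" where
  "minus_ess X Y = X + - Y"

instance
proof
  fix X Y Z :: "'a ess" and c d :: real
  note adm = ess_rel_refl_iff bounded_seq_add bounded_seq_uminus
    bounded_seq_linear[OF bounded_linear_scaleR_right]
  show "X + Y + Z = X + (Y + Z)" by transfer (simp add: adm add.assoc)
  show "X + Y = Y + X" by transfer (simp add: adm add.commute)
  show "0 + X = X" by transfer simp
  show "- X + X = 0" by transfer (simp add: ess_rel_refl_iff bounded_seqI[of _ 0])
  show "X - Y = X + - Y" by (rule minus_ess_def)
  show "c *\<^sub>R (X + Y) = c *\<^sub>R X + c *\<^sub>R Y" by transfer (simp add: adm scaleR_add_right)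
  show "(c + d) *\<^sub>R X = c *\<^sub>R X + d *\<^sub>R X" by transfer (simp add: adm scaleR_add_left)
  show "c *\<^sub>R d *\<^sub>R X = (c * d) *\<^sub>R X" by transfer (simp add: adm)
  show "1 *\<^sub>R X = X" by transfer simp
qed

end

lemma minus_ess_abs: "bounded_seq x \<Longrightarrow> bounded_seq y \<Longrightarrow> abs_ess x - abs_ess y = abs_ess (\<lambda>n. x n - y n)"
  unfolding minus_ess_def
  by (subst uminus_ess.abs_eq, simp add: ess_rel_refl_iff, subst plus_ess.abs_eq)
    (simp_all add: ess_rel_refl_iff bounded_seq_uminus)

lemma plus_ess_abs: "bounded_seq x \<Longrightarrow> bounded_seq y \<Longrightarrow> abs_ess x + abs_ess y = abs_ess (\<lambda>n. x n + y n)"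
  by (simp add: plus_ess.abs_eq ess_rel_refl_iff)

lemma abs_ess_eq_iff: "bounded_seq x \<Longrightarrow> bounded_seq y \<Longrightarrow> abs_ess x = abs_ess y \<longleftrightarrow> totally_bounded_seq (\<lambda>n. x n - y n)"
  using Quotient_rel[OF Quotient_ess, of x y] by (auto simp: ess_rel_def totally_bounded_seq_const)

lemma ess_cases [cases type]:
  obtains x where "Y = abs_ess x" "bounded_seq x"
proof -
  have "ess_rel (rep_ess Y) (rep_ess Y)" by (rule Quotient_rep_reflp[OF Quotient_ess])
  then show thesis using that[of "rep_ess Y"] Quotient_abs_rep[OF Quotient_ess, of Y]
    by (simp add: ess_rel_refl_iff)
qed

instantiation ess :: (complex_normed_vector) complex_normed_vector
begin

definition dist_ess :: "'a ess \<Rightarrow> 'a ess \<Rightarrow> real" where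
  "dist_ess X Y = norm (X - Y)"

definition uniformity_ess :: "('a ess \<times> 'a ess) filter" where
  "uniformity_ess = (INF e\<in>{0<..}. principal {(X, Y). dist X Y < e})"

definition open_ess :: "'a ess set \<Rightarrow> bool" where
  "open_ess U \<longleftrightarrow> (\<forall>X\<in>U. \<forall>\<^sub>F (X', Y) in uniformity. X' = X \<longrightarrow> Y \<in> U)"

definition sgn_ess :: "'a ess \<Rightarrow> 'a ess" where
  "sgn_ess X = X /\<^sub>R norm X"

lift_definition scaleC_ess :: "complex \<Rightarrow> 'a ess \<Rightarrow> 'a ess" is "\<lambda>c x n. c *\<^sub>C x n"
  using ess_rel_linear[OF bounded_linear_scaleC] .

instance
proof
  fix X Y :: "'a ess" and a b :: real and c d :: complex
  note adm = ess_rel_refl_iff bounded_seq_add bounded_seq_uminus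
    bounded_seq_linear[OF bounded_linear_scaleR_right] bounded_seq_linear[OF bounded_linear_scaleC]
  show "dist X Y = norm (X - Y)" by (rule dist_ess_def)
  show "sgn X = X /\<^sub>R norm X" by (rule sgn_ess_def)
  show "(uniformity :: ('a ess \<times> 'a ess) filter) = (INF e\<in>{0<..}. principal {(X, Y). dist X Y < e})"
    by (rule uniformity_ess_def)
  show "open U \<longleftrightarrow> (\<forall>X\<in>U. \<forall>\<^sub>F (X', Y) in uniformity. X' = X \<longrightarrow> Y \<in> U)" for U :: "'a ess set"
    by (rule open_ess_def)
  show "norm X = 0 \<longleftrightarrow> X = 0"
    by transfer (simp add: ess_rel_refl_iff ess_rel_def covering_radius_zero_iff bounded_seqI[of _ 0])
  show "norm (X + Y) \<le> norm X + norm Y"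
    by transfer (simp add: ess_rel_refl_iff covering_radius_add)
  have scaleR_scaleC': "a *\<^sub>R X = complex_of_real a *\<^sub>C X" for a
    by transfer (simp add: adm scaleR_scaleC)
  have norm_scaleC': "norm (c *\<^sub>C X) = cmod c * norm X" for c
    by transfer (simp add: adm covering_radius_scaleC)
  show "a *\<^sub>R X = complex_of_real a *\<^sub>C X" by (rule scaleR_scaleC')
  show "norm (c *\<^sub>C X) = cmod c * norm X" by (rule norm_scaleC')
  show "norm (a *\<^sub>R X) = \<bar>a\<bar> * norm X" by (simp add: scaleR_scaleC' norm_scaleC')
  show "c *\<^sub>C (X + Y) = c *\<^sub>C X + c *\<^sub>C Y" by transfer (simp add: adm scaleC_add_right)
  show "(c + d) *\<^sub>C X = c *\<^sub>C X + d *\<^sub>C X" by transfer (simp add: adm scaleC_add_left)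
  show "c *\<^sub>C d *\<^sub>C X = (c * d) *\<^sub>C X" by transfer (simp add: adm scaleC_scaleC)
  show "1 *\<^sub>C X = X" by transfer (simp add: scaleC_one)
qed

end

lemma norm_ess_abs: "bounded_seq x \<Longrightarrow> norm (abs_ess x) = covering_radius x"
  by (simp add: norm_ess.abs_eq ess_rel_refl_iff)

text \<open>
  Subtracting from each member of the sequence the centre of a ball that contains it changes the
  sequence only by one with finitely many values. So the norm is also the quotient norm of the
  supremum norm.
\<close>

lemma ess_small_representative:
  assumes "norm Y < r"
  obtains x where "Y = abs_ess x" "\<And>n. norm (x n) \<le> r" "bounded_seq x"
proof -
  obtain z where z: "Y = abs_ess z" "bounded_seq z" by (rule ess_cases)
  then have "covered r z"
    using assms covered_if_covering_radius_less by (simp add: norm_ess_abs)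
  then obtain F where F: "finite F" "\<forall>n. \<exists>f\<in>F. norm (z n - f) \<le> r"
    unfolding covered_def by auto
  then obtain f where f: "\<And>n. f n \<in> F" "\<And>n. norm (z n - f n) \<le> r" by metis
  have "covered s f" if "s > 0" for s
  proof (rule coveredI[OF F(1)])
    show "\<exists>g\<in>F. norm (f n - g) \<le> s" for n
      using f(1) that by (intro bexI[of _ "f n"]) auto
  qed
  then have fs: "totally_bounded_seq f" by (simp add: totally_bounded_seq_def)
  have fa: "bounded_seq f" using fs unfolding totally_bounded_seq_def bounded_seq_def by (meson zero_less_one)
  have "Y = abs_ess (\<lambda>n. z n - f n)"
    using z fs fa by (simp add: abs_ess_eq_iff bounded_seq_diff)
  then show thesis using that[of "\<lambda>n. z n - f n"] f(2) z(2) fa by (simp add: bounded_seq_diff)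
qed

lemma norm_ess_le: "norm (abs_ess x) \<le> r" if "\<And>n. norm (x n) \<le> r"
proof -
  have "bounded_seq x" "covering_radius x \<le> r"
    by (rule bounded_seqI[OF that], rule covering_radius_le[OF covered_bounded[OF that]])
  then show ?thesis by (simp add: norm_ess_abs)
qed

lemma sum_ess_abs: "(\<Sum>k<(K::nat). abs_ess (y k)) = abs_ess (\<lambda>n. \<Sum>k<K. y k n) \<and> bounded_seq (\<lambda>n. \<Sum>k<K. y k n)"
  if "\<And>k. bounded_seq (y k)"
proof (induction K)
  case 0
  then show ?case using zero_ess.abs_eq[symmetric] bounded_seqI[of "\<lambda>_. 0" 0] by simp
next
  case (Suc K)
  then show ?case using that by (simp add: plus_ess_abs bounded_seq_add)
qed

instance ess :: (cbanach) cbanach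
proof
  fix X :: "nat \<Rightarrow> 'a ess" assume "Cauchy X"
  then have "\<forall>k. \<exists>N. \<forall>m\<ge>N. \<forall>n\<ge>N. norm (X m - X n) < (1/2)^k"
    by (auto intro!: CauchyD)
  then obtain N where N: "\<And>k m n. N k \<le> m \<Longrightarrow> N k \<le> n \<Longrightarrow> norm (X m - X n) < (1/2)^k"
    by metis
  \<comment> \<open>indices of a subsequence with geometrically decreasing steps; the sum makes \<open>M\<close> monotone\<close>
  define M where "M k = (\<Sum>i\<le>k. N i)" for k
  have NM: "N k \<le> M k" "N k \<le> M (Suc k)" for k
    unfolding M_def by (simp_all add: member_le_sum trans_le_add1)
  have "\<exists>y. X (M (Suc k)) - X (M k) = abs_ess y \<and> (\<forall>n. norm (y n) \<le> (1/2)^k) \<and> bounded_seq y" for k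
    using ess_small_representative[OF N[OF NM(2,1)], of k] by metis
  then obtain y where y: "\<And>k. X (M (Suc k)) - X (M k) = abs_ess (y k)"
    "\<And>k n. norm (y k n) \<le> (1/2)^k" "\<And>k. bounded_seq (y k)" by metis
  obtain x where x: "X (M 0) = abs_ess x" "bounded_seq x" by (rule ess_cases)
  have summ: "summable (\<lambda>k. y k n)" for n
    using y(2) by (intro summable_comparison_test[OF _ summable_geometric[of "1/2"]]) auto
  have tail: "norm ((\<Sum>k. y k n) - (\<Sum>k<K. y k n)) \<le> 2 * (1/2)^K" for K n
  proof -
    have "(\<Sum>k. y k n) - (\<Sum>k<K. y k n) = (\<Sum>k. y (k + K) n)"
      using suminf_minus_initial_segment[OF summ, of K n] by simp
    also have "norm \<dots> \<le> (\<Sum>k. (1/2)^(k + K))"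
      using y(2) summable_geometric[of "1/2 :: real"]
      by (intro norm_suminf_le summable_ignore_initial_segment) auto
    finally show ?thesis
      by (simp add: power_add suminf_mult2[symmetric] suminf_geometric summable_geometric)
  qed
  define z where "z n = x n + (\<Sum>k. y k n)" for n
  have sadm: "bounded_seq (\<lambda>n. \<Sum>k. y k n)"
    using tail[of _ 0] by (intro bounded_seqI[of _ 2]) simp
  then have zadm: "bounded_seq z" unfolding z_def using x(2) by (intro bounded_seq_add)
  have conv: "norm (X (M K) - abs_ess z) \<le> 2 * (1/2)^K" for K
  proof -
    have "X (M K) = X (M 0) + (\<Sum>k<K. X (M (Suc k)) - X (M k))"
      by (simp add: sum_lessThan_telescope[of "\<lambda>k. X (M k)"])
    also have "\<dots> = abs_ess (\<lambda>n. x n + (\<Sum>k<K. y k n))"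
      using sum_ess_abs[OF y(3), where K=K] x by (simp add: y(1) plus_ess_abs)
    finally have "X (M K) - abs_ess z = abs_ess (\<lambda>n. (x n + (\<Sum>k<K. y k n)) - z n)"
      using sum_ess_abs[OF y(3), where K=K] x zadm by (simp add: minus_ess_abs bounded_seq_add)
    moreover have "norm ((x n + (\<Sum>k<K. y k n)) - z n) \<le> 2 * (1/2)^K" for n
      using tail[of n K] by (simp add: z_def norm_minus_commute)
    ultimately show ?thesis by (simp add: norm_ess_le)
  qed
  have "X \<longlonglongrightarrow> abs_ess z"
  proof (rule LIMSEQ_I)
    fix e :: real assume "e > 0"
    then obtain K where K: "(1/2)^K < e / 3" using real_arch_pow_inv[of "e/3" "1/2"] by auto
    have "norm (X n - abs_ess z) < e" if "n \<ge> N K" for n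
    proof -
      have "norm (X n - abs_ess z) \<le> norm (X n - X (M K)) + norm (X (M K) - abs_ess z)"
        using norm_triangle_ineq[of "X n - X (M K)" "X (M K) - abs_ess z"] by simp
      also have "\<dots> < (1/2)^K + 2 * (1/2)^K"
        using N[OF that NM(1)] conv[of K] by linarith
      finally show ?thesis using K by simp
    qed
    then show "\<exists>no. \<forall>n\<ge>no. norm (X n - abs_ess z) < e" by blast
  qed
  then show "convergent X" by (rule convergentI)
qed

section \<open>The spectrum of an operator on a Banach space\<close>

definition has_bounded_inverse :: "('a::real_normed_vector \<Rightarrow> 'a) \<Rightarrow> bool" where
  "has_bounded_inverse S \<longleftrightarrow> surj S \<and> (\<exists>c>0. \<forall>x. c * norm x \<le> norm (S x))"

text \<open>
  A surjective operator that is bounded below has a bounded inverse, so for a bounded linear \<open>S\<close>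
  this is the usual spectrum.
\<close>

definition op_spectrum :: "('a::complex_normed_vector \<Rightarrow> 'a) \<Rightarrow> complex set" where
  "op_spectrum S = {\<mu>. \<not> has_bounded_inverse (\<lambda>x. \<mu> *\<^sub>C x - S x)}"

text \<open>
  A solution of \<open>S x = z\<close> is a fixed point of \<open>x \<mapsto> T\<inverse> (z - (S - T) x)\<close>, which is a contraction with
  factor \<open>d / c\<close>.
\<close>

lemma surj_perturbation:
  fixes T S :: "'a::banach \<Rightarrow> 'a"
  assumes T: "linear T" and S: "linear S" and surj: "surj T"
    and lower: "\<And>x. c * norm x \<le> norm (T x)"
    and close: "\<And>x. norm (S x - T x) \<le> d * norm x" and d: "0 \<le> d" "d < c"
  shows "surj S"
proof -
  have "\<exists>x. S x = z" for z
  proof -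
    define g where "g x = (SOME u. T u = z - (S x - T x))" for x
    have g: "T (g x) = z - (S x - T x)" for x
      unfolding g_def by (rule someI_ex) (metis surj surjD)
    \<comment> \<open>the lower bound of \<open>T\<close> replaces a norm bound of its inverse\<close>
    have "dist (g x) (g y) \<le> (d / c) * dist x y" for x y
    proof -
      have "c * norm (g x - g y) \<le> norm (T (g x - g y))" by (rule lower)
      also have "T (g x - g y) = - (S (x - y) - T (x - y))"
        by (simp add: linear_diff[OF T] linear_diff[OF S] g)
      also have "norm \<dots> \<le> d * norm (x - y)" using close[of "x - y"] by (simp only: norm_minus_cancel)
      finally show ?thesis using d by (simp add: dist_norm field_simps)
    qed
    then obtain x where "g x = x"
      using banach_fix_type[of "d / c" g] d by auto
    then have "S x = z" using g[of x] by simp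
    then show ?thesis by blast
  qed
  then show ?thesis by (metis surjI)
qed

lemma clinear_pencil:
  assumes "bounded_clinear A"
  shows "bounded_clinear (\<lambda>x. \<mu> *\<^sub>C x - A x)"
  using assms unfolding bounded_clinear_def
  by (auto intro!: bounded_linear_sub bounded_linear_scaleC
      simp: scaleC_scaleC complex_vector.scale_right_diff_distrib mult.commute)

lemma linear_pencil: "linear (\<lambda>x. \<mu> *\<^sub>C x - A x)" if "bounded_clinear A"
  using clinear_pencil[OF that] by (simp add: bounded_clinear_def bounded_linear.linear)

lemma pencil_lower_bound:
  assumes lower: "\<And>x. c * norm x \<le> norm (\<mu> *\<^sub>C x - A x)"
  shows "(c - cmod (\<nu> - \<mu>)) * norm x \<le> norm (\<nu> *\<^sub>C x - A x)"
proof -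
  have eq: "\<nu> *\<^sub>C x - A x = (\<mu> *\<^sub>C x - A x) + (\<nu> - \<mu>) *\<^sub>C x"
    by (simp add: complex_vector.scale_left_diff_distrib)
  have "norm (\<mu> *\<^sub>C x - A x) - norm ((\<nu> - \<mu>) *\<^sub>C x) \<le> norm (\<nu> *\<^sub>C x - A x)"
    unfolding eq by (rule norm_diff_ineq)
  then show ?thesis using lower[of x] unfolding norm_scaleC left_diff_distrib by linarith
qed

lemma pencil_surj:
  fixes A :: "'a::cbanach \<Rightarrow> 'a"
  assumes A: "bounded_clinear A" and "surj (\<lambda>x. \<mu> *\<^sub>C x - A x)"
    and lower: "\<And>x. c * norm x \<le> norm (\<mu> *\<^sub>C x - A x)" and "cmod (\<nu> - \<mu>) < c"
  shows "surj (\<lambda>x. \<nu> *\<^sub>C x - A x)"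
proof (rule surj_perturbation[OF linear_pencil[OF A] linear_pencil[OF A] assms(2) lower])
  show "norm ((\<nu> *\<^sub>C x - A x) - (\<mu> *\<^sub>C x - A x)) \<le> cmod (\<nu> - \<mu>) * norm x" for x
    using norm_scaleC[of "\<nu> - \<mu>" x] by (simp add: complex_vector.scale_left_diff_distrib)
qed (use assms in auto)

lemma pencil_has_bounded_inverse:
  fixes A :: "'a::cbanach \<Rightarrow> 'a"
  assumes A: "bounded_clinear A" and "surj (\<lambda>x. \<mu> *\<^sub>C x - A x)"
    and lower: "\<And>x. c * norm x \<le> norm (\<mu> *\<^sub>C x - A x)" and "cmod (\<nu> - \<mu>) < c"
  shows "has_bounded_inverse (\<lambda>x. \<nu> *\<^sub>C x - A x)"
  unfolding has_bounded_inverse_def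
proof (intro conjI exI[of _ "c - cmod (\<nu> - \<mu>)"] allI)
  show "(c - cmod (\<nu> - \<mu>)) * norm x \<le> norm (\<nu> *\<^sub>C x - A x)" for x
    by (rule pencil_lower_bound[OF lower])
qed (use pencil_surj[OF assms] assms(4) in auto)

lemma closed_op_spectrum:
  fixes A :: "'a::cbanach \<Rightarrow> 'a"
  assumes "bounded_clinear A"
  shows "closed (op_spectrum A)"
proof -
  have "open (- op_spectrum A)"
    unfolding open_contains_ball
  proof
    fix \<mu> assume "\<mu> \<in> - op_spectrum A"
    then obtain c where c: "c > 0" "\<forall>x. c * norm x \<le> norm (\<mu> *\<^sub>C x - A x)"
      and s: "surj (\<lambda>x. \<mu> *\<^sub>C x - A x)"
      unfolding op_spectrum_def has_bounded_inverse_def by auto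
    have "ball \<mu> c \<subseteq> - op_spectrum A"
      using pencil_has_bounded_inverse[OF assms s, of c] c(2)
      by (auto simp: op_spectrum_def dist_norm norm_minus_commute)
    then show "\<exists>e>0. ball \<mu> e \<subseteq> - op_spectrum A" using c(1) by blast
  qed
  then show ?thesis by (simp add: closed_def)
qed

lemma pencil_lower_bound_large:
  assumes "\<And>x. norm (A x) \<le> K * norm x"
  shows "(cmod \<mu> - K) * norm x \<le> norm (\<mu> *\<^sub>C x - A x)"
  using norm_triangle_ineq2[of "\<mu> *\<^sub>C x" "A x"] assms[of x]
  by (simp add: norm_scaleC left_diff_distrib)

lemma surj_pencil_large:
  fixes A :: "'a::cbanach \<Rightarrow> 'a"
  assumes A: "bounded_clinear A" and K: "\<And>x. norm (A x) \<le> K * norm x" "0 \<le> K" "K < cmod \<mu>"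
  shows "surj (\<lambda>x. \<mu> *\<^sub>C x - A x)"
proof (rule surj_perturbation[of "\<lambda>x. \<mu> *\<^sub>C x" _ "cmod \<mu>" K])
  show "linear (\<lambda>x :: 'a. \<mu> *\<^sub>C x)" by (rule bounded_linear.linear[OF bounded_linear_scaleC])
  have "\<mu> \<noteq> 0" using K by auto
  then have "\<mu> *\<^sub>C inverse \<mu> *\<^sub>C z = z" for z :: 'a by (simp add: scaleC_scaleC scaleC_one)
  then show "surj (\<lambda>x :: 'a. \<mu> *\<^sub>C x)" by (metis surjI)
qed (use K linear_pencil[OF A] in \<open>auto simp: norm_scaleC\<close>)

lemma op_spectrum_bounded:
  fixes A :: "'a::cbanach \<Rightarrow> 'a"
  assumes A: "bounded_clinear A"
  obtains K where "K > 0" "\<And>x. norm (A x) \<le> K * norm x" "\<And>\<mu>. \<mu> \<in> op_spectrum A \<Longrightarrow> cmod \<mu> \<le> K"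
proof -
  obtain K where K: "K > 0" "\<And>x. norm (A x) \<le> norm x * K"
    using bounded_linear.pos_bounded A unfolding bounded_clinear_def by blast
  have K': "norm (A x) \<le> K * norm x" for x using K(2)[of x] by (simp add: mult.commute)
  have "\<mu> \<notin> op_spectrum A" if "K < cmod \<mu>" for \<mu>
    unfolding op_spectrum_def has_bounded_inverse_def
    using surj_pencil_large[OF A K', of \<mu>] pencil_lower_bound_large[of A K, OF K', of \<mu>] that K(1)
    by (auto intro!: exI[of _ "cmod \<mu> - K"])
  then show thesis using that[OF K(1) K'] by (meson not_le)
qed

text \<open>
  If the spectrum is empty, the resolvent \<open>R \<nu> y\<close>, followed by a complex functional, is an
  entire function that tends to \<open>0\<close> at infinity, hence vanishes by Liouville's theorem.
  Choosing the functional to be norming for \<open>R 0 y\<close> yields \<open>y = 0\<close>.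
\<close>

theorem op_spectrum_nonempty:
  fixes A :: "'a::cbanach \<Rightarrow> 'a" and y :: 'a
  assumes A: "bounded_clinear A" and "y \<noteq> 0"
  shows "op_spectrum A \<noteq> {}"
proof
  assume empty: "op_spectrum A = {}"
  define R where "R \<mu> z = (SOME x. \<mu> *\<^sub>C x - A x = z)" for \<mu> z
  have surj: "surj (\<lambda>x. \<mu> *\<^sub>C x - A x)" for \<mu>
    using empty unfolding op_spectrum_def has_bounded_inverse_def by blast
  have lower: "\<exists>c>0. \<forall>x. c * norm x \<le> norm (\<mu> *\<^sub>C x - A x)" for \<mu>
    using empty unfolding op_spectrum_def has_bounded_inverse_def by blast
  have R: "\<mu> *\<^sub>C R \<mu> z - A (R \<mu> z) = z" for \<mu> z
  proof -
    have "\<exists>x. \<mu> *\<^sub>C x - A x = z" using surjD[OF surj[of \<mu>], of z] by auto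
    then show ?thesis unfolding R_def by (rule someI_ex)
  qed
  have R_unique: "R \<mu> z = x" if x: "\<mu> *\<^sub>C x - A x = z" for \<mu> x z
  proof -
    obtain c where c: "c > 0" "\<forall>x. c * norm x \<le> norm (\<mu> *\<^sub>C x - A x)" using lower by blast
    have "\<mu> *\<^sub>C (R \<mu> z - x) - A (R \<mu> z - x) = 0"
      using linear_diff[OF linear_pencil[OF A], of \<mu> "R \<mu> z" x] R[of \<mu> z] x by simp
    then have "c * norm (R \<mu> z - x) \<le> 0" using c(2) by (metis norm_zero)
    then show ?thesis using c(1) by (simp add: mult_le_0_iff)
  qed
  \<comment> \<open>the resolvent identity; it yields continuity and then differentiability of the resolvent\<close>
  have resolvent: "R \<nu> z - R \<mu> z = (\<mu> - \<nu>) *\<^sub>C R \<nu> (R \<mu> z)" for \<mu> \<nu> z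
  proof -
    have "\<nu> *\<^sub>C (R \<mu> z + (\<mu> - \<nu>) *\<^sub>C R \<nu> (R \<mu> z)) - A (R \<mu> z + (\<mu> - \<nu>) *\<^sub>C R \<nu> (R \<mu> z))
        = (\<nu> *\<^sub>C R \<mu> z - A (R \<mu> z)) + (\<mu> - \<nu>) *\<^sub>C (\<nu> *\<^sub>C R \<nu> (R \<mu> z) - A (R \<nu> (R \<mu> z)))"
      using A unfolding bounded_clinear_def
      by (simp add: linear_add[OF bounded_linear.linear] scaleC_add_right scaleC_scaleC
          complex_vector.scale_right_diff_distrib mult.commute)
    also have "\<dots> = (\<nu> *\<^sub>C R \<mu> z - A (R \<mu> z)) + (\<mu> - \<nu>) *\<^sub>C R \<mu> z" by (simp add: R)
    also have "\<dots> = \<mu> *\<^sub>C R \<mu> z - A (R \<mu> z)" by (simp add: complex_vector.scale_left_diff_distrib)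
    also have "\<dots> = z" by (rule R)
    finally have "R \<nu> z = R \<mu> z + (\<mu> - \<nu>) *\<^sub>C R \<nu> (R \<mu> z)" by (rule R_unique)
    then show ?thesis by simp
  qed
  have R_cont: "((\<lambda>\<nu>. R \<nu> z) \<longlongrightarrow> R \<mu> z) (at \<mu>)" for \<mu> z
  proof -
    obtain c where c: "c > 0" "\<forall>x. c * norm x \<le> norm (\<mu> *\<^sub>C x - A x)" using lower by blast
    have "norm (R \<nu> z - R \<mu> z) \<le> cmod (\<nu> - \<mu>) * (2 * norm (R \<mu> z) / c)" if "cmod (\<nu> - \<mu>) < c / 2" for \<nu>
    proof -
      have "(c - cmod (\<nu> - \<mu>)) * norm (R \<nu> (R \<mu> z)) \<le> norm (R \<mu> z)"
        using pencil_lower_bound[of c \<mu> A \<nu> "R \<nu> (R \<mu> z)"] c(2) by (simp add: R)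
      moreover have "(c / 2) * norm (R \<nu> (R \<mu> z)) \<le> (c - cmod (\<nu> - \<mu>)) * norm (R \<nu> (R \<mu> z))"
        using that by (intro mult_right_mono) auto
      ultimately have "norm (R \<nu> (R \<mu> z)) \<le> 2 * norm (R \<mu> z) / c" using c(1) by (simp add: field_simps)
      then show ?thesis
        unfolding resolvent norm_scaleC norm_minus_commute[of \<mu> \<nu>] by (rule mult_left_mono) simp
    qed
    then have ev: "\<forall>\<^sub>F \<nu> in at \<mu>. norm (R \<nu> z - R \<mu> z) \<le> cmod (\<nu> - \<mu>) * (2 * norm (R \<mu> z) / c)"
      using c(1) unfolding eventually_at dist_norm by (intro exI[of _ "c / 2"]) auto
    have "((\<lambda>\<nu>. cmod (\<nu> - \<mu>) * (2 * norm (R \<mu> z) / c)) \<longlongrightarrow> 0) (at \<mu>)"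
      by (rule tendsto_eq_intros refl | simp)+
    then have "((\<lambda>\<nu>. R \<nu> z - R \<mu> z) \<longlongrightarrow> 0) (at \<mu>)"
      using ev by (rule Lim_null_comparison[rotated])
    then show ?thesis by (simp add: LIM_zero_iff)
  qed
  obtain f :: "'a \<Rightarrow> real" where f: "bounded_linear f" "\<And>x. \<bar>f x\<bar> \<le> norm x"
    "f (R 0 y) = norm (R 0 y)" using norming_functional by blast
  \<comment> \<open>the complex-linear functional with real part \<open>f\<close>\<close>
  define \<psi> where "\<psi> x = Complex (f x) (- f (\<i> *\<^sub>C x))" for x
  have \<psi>_add: "\<psi> (x + z) = \<psi> x + \<psi> z" for x z
    by (simp add: \<psi>_def linear_add[OF bounded_linear.linear[OF f(1)]] scaleC_add_right complex_eq_iff)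
  have f_cplx: "f (c *\<^sub>C x) = Re c * f x + Im c * f (\<i> *\<^sub>C x)" for c x
  proof -
    have "c *\<^sub>C x = Re c *\<^sub>R x + Im c *\<^sub>R (\<i> *\<^sub>C x)"
      unfolding scaleR_scaleC scaleC_scaleC scaleC_add_left[symmetric]
      by (metis complex_eq mult.commute)
    then show ?thesis
      by (simp add: linear_add[OF bounded_linear.linear[OF f(1)]] linear_scale[OF bounded_linear.linear[OF f(1)]])
  qed
  have \<psi>_scale: "\<psi> (c *\<^sub>C x) = c * \<psi> x" for c x
    using f_cplx[of c x] f_cplx[of "\<i> * c" x]
    by (simp add: \<psi>_def complex_eq_iff scaleC_scaleC)
  have \<psi>_bound: "cmod (\<psi> x) \<le> 2 * norm x" for x
    using cmod_le[of "\<psi> x"] f(2)[of x] f(2)[of "\<i> *\<^sub>C x"] by (simp add: \<psi>_def norm_scaleC)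
  have \<psi>_lin: "bounded_linear \<psi>"
    by (rule bounded_linear_intro[where K=2])
      (use \<psi>_add \<psi>_scale \<psi>_bound in \<open>auto simp: scaleR_scaleC scaleR_conv_of_real mult.commute\<close>)
  have deriv: "((\<lambda>\<nu>. \<psi> (R \<nu> y)) has_field_derivative - \<psi> (R \<mu> (R \<mu> y))) (at \<mu>)" for \<mu>
    unfolding has_field_derivative_iff
  proof (rule Lim_transform_eventually)
    show "((\<lambda>\<nu>. - \<psi> (R \<nu> (R \<mu> y))) \<longlongrightarrow> - \<psi> (R \<mu> (R \<mu> y))) (at \<mu>)"
      by (intro tendsto_minus bounded_linear.tendsto[OF \<psi>_lin] R_cont)
    have "- \<psi> (R \<nu> (R \<mu> y)) = (\<psi> (R \<nu> y) - \<psi> (R \<mu> y)) / (\<nu> - \<mu>)" if "\<nu> \<noteq> \<mu>" for \<nu>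
    proof -
      have "\<psi> (R \<nu> y) - \<psi> (R \<mu> y) = \<psi> (R \<nu> y - R \<mu> y)"
        by (simp add: linear_diff[OF bounded_linear.linear[OF \<psi>_lin]])
      also have "\<dots> = (\<mu> - \<nu>) * \<psi> (R \<nu> (R \<mu> y))" unfolding resolvent \<psi>_scale ..
      finally show ?thesis using that by (simp add: field_simps)
    qed
    then show "\<forall>\<^sub>F \<nu> in at \<mu>. - \<psi> (R \<nu> (R \<mu> y)) = (\<psi> (R \<nu> y) - \<psi> (R \<mu> y)) / (\<nu> - \<mu>)"
      by (intro eventually_at_filter[THEN iffD2] always_eventually) auto
  qed
  then have hol: "(\<lambda>\<nu>. \<psi> (R \<nu> y)) holomorphic_on UNIV"
    unfolding holomorphic_on_def field_differentiable_def by auto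
  obtain K where K: "K > 0" "\<And>x. norm (A x) \<le> K * norm x"
    "\<And>\<mu>. \<mu> \<in> op_spectrum A \<Longrightarrow> cmod \<mu> \<le> K"
    using op_spectrum_bounded[OF A] by blast
  have decay: "cmod (\<psi> (R \<mu> y)) \<le> (4 * norm y) / cmod \<mu>" if \<mu>: "cmod \<mu> \<ge> 2 * K" for \<mu>
  proof -
    have "(cmod \<mu> / 2) * norm (R \<mu> y) \<le> (cmod \<mu> - K) * norm (R \<mu> y)"
      using \<mu> by (intro mult_right_mono) auto
    also have "\<dots> \<le> norm y" using pencil_lower_bound_large[of A K \<mu> "R \<mu> y"] K(2) by (simp add: R)
    finally have "cmod \<mu> * norm (R \<mu> y) \<le> 2 * norm y" by simp
    moreover have "cmod \<mu> > 0" using \<mu> K(1) by linarith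
    ultimately have "norm (R \<mu> y) \<le> 2 * norm y / cmod \<mu>" by (simp add: field_simps)
    then show ?thesis using \<psi>_bound[of "R \<mu> y"] by simp
  qed
  have "((\<lambda>\<mu>. \<psi> (R \<mu> y)) \<longlongrightarrow> 0) at_infinity"
  proof (rule Lim_null_comparison)
    show "\<forall>\<^sub>F \<mu> in at_infinity. cmod (\<psi> (R \<mu> y)) \<le> (4 * norm y) / cmod \<mu>"
      unfolding eventually_at_infinity using decay by blast
    show "((\<lambda>\<mu>. (4 * norm y) / cmod \<mu>) \<longlongrightarrow> 0) at_infinity"
      by (intro tendsto_divide_0[OF tendsto_const] filterlim_at_top_imp_at_infinity filterlim_norm_at_top)
  qed
  then have "\<psi> (R 0 y) = 0" using Liouville_weak_0[OF hol] by blast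
  then have "norm (R 0 y) = 0" using f(3) by (simp add: \<psi>_def complex_eq_iff)
  then have "R 0 y = 0" by simp
  then have "y = 0" using R[of 0 y] linear_0[OF linear_pencil[OF A, of 0]] by metis
  then show False using assms(2) by simp
qed

lemma op_spectrum_max_modulus:
  fixes A :: "'a::cbanach \<Rightarrow> 'a" and y :: 'a
  assumes A: "bounded_clinear A" and "y \<noteq> 0"
  obtains \<mu> where "\<mu> \<in> op_spectrum A" "\<And>\<nu>. \<nu> \<in> op_spectrum A \<Longrightarrow> cmod \<nu> \<le> cmod \<mu>"
proof -
  have "bounded (op_spectrum A)"
    using op_spectrum_bounded[OF A] unfolding bounded_iff by metis
  then have "compact (op_spectrum A)"
    using closed_op_spectrum[OF A] by (simp add: compact_eq_bounded_closed)
  then show thesis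
    using continuous_attains_sup[of "op_spectrum A" cmod] op_spectrum_nonempty[OF assms] that
    by (auto intro: continuous_on_norm_id)
qed

text \<open>
  Otherwise \<open>\<mu> - A\<close> is bounded below. Points slightly farther out than \<open>\<mu>\<close> are outside the
  spectrum, and invertibility there passes to \<open>\<mu>\<close>, because the size of the neighbourhood on which it
  persists depends on the lower bound only.
\<close>

lemma approximate_eigenvector:
  fixes A :: "'a::cbanach \<Rightarrow> 'a"
  assumes A: "bounded_clinear A" and \<mu>: "\<mu> \<in> op_spectrum A"
    and max: "\<And>\<nu>. \<nu> \<in> op_spectrum A \<Longrightarrow> cmod \<nu> \<le> cmod \<mu>" and "\<epsilon> > 0"
  obtains x where "norm (\<mu> *\<^sub>C x - A x) < \<epsilon> * norm x"
proof -
  have "\<exists>x. norm (\<mu> *\<^sub>C x - A x) < \<epsilon> * norm x"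
  proof (rule ccontr)
    assume "\<not> ?thesis"
    then have lower: "\<epsilon> * norm x \<le> norm (\<mu> *\<^sub>C x - A x)" for x by (meson not_le)
    define u where "u = (if \<mu> = 0 then 1 else \<mu> / cmod \<mu>)"
    \<comment> \<open>the point at distance \<open>\<epsilon> / 3\<close> from \<open>\<mu>\<close> in the radial direction\<close>
    define \<nu> where "\<nu> = \<mu> + (\<epsilon> / 3) * u"
    have u: "cmod u = 1" "\<mu> = cmod \<mu> * u" unfolding u_def by (auto simp: norm_divide)
    have dist: "cmod (\<nu> - \<mu>) = \<epsilon> / 3"
      unfolding \<nu>_def using u(1) assms(4) by (simp add: norm_mult norm_divide)
    have "\<nu> = (cmod \<mu> + \<epsilon> / 3) * u"
      unfolding \<nu>_def by (subst u(2)) (simp add: algebra_simps)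
    then have "cmod \<nu> = \<bar>cmod \<mu> + \<epsilon> / 3\<bar>"
      using u(1) by (simp only: norm_mult norm_of_real mult_1_right)
    then have "cmod \<nu> = cmod \<mu> + \<epsilon> / 3" using assms(4) by simp
    then have "\<nu> \<notin> op_spectrum A" using max[of \<nu>] assms(4) by auto
    then have "surj (\<lambda>x. \<nu> *\<^sub>C x - A x)"
      unfolding op_spectrum_def has_bounded_inverse_def by blast
    moreover have "(\<epsilon> - \<epsilon> / 3) * norm x \<le> norm (\<nu> *\<^sub>C x - A x)" for x
      using pencil_lower_bound[of \<epsilon> \<mu> A \<nu> x, OF lower] unfolding dist .
    ultimately have "has_bounded_inverse (\<lambda>x. \<mu> *\<^sub>C x - A x)"
      using dist assms(4)
      by (intro pencil_has_bounded_inverse[OF A, of \<nu> "\<epsilon> - \<epsilon> / 3"]) (simp_all add: norm_minus_commute)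
    then show False using \<mu> by (simp add: op_spectrum_def)
  qed
  then show thesis using that by blast
qed

section \<open>The open mapping theorem\<close>

text \<open>
  Halving the residual again and again and adding up the corrections. Confining the residuals to
  \<open>V\<close> makes the lemma applicable when \<open>V\<close> is the whole space (open mapping theorem), the range of an
  operator enlarged by finitely many vectors, or a kernel.
\<close>

lemma successive_approximation:
  fixes T :: "'a::banach \<Rightarrow> 'b::real_normed_vector"
  assumes T: "bounded_linear T" and "0 \<le> C"
    and step: "\<And>y. y \<in> V \<Longrightarrow> \<exists>x. norm x \<le> C * norm y \<and> y - T x \<in> V \<and> norm (y - T x) \<le> norm y / 2"
    and y: "y \<in> V"
  obtains x where "T x = y" "norm x \<le> 2 * C * norm y"
proof -
  obtain g where g: "\<And>y. y \<in> V \<Longrightarrow> norm (g y) \<le> C * norm y"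
    "\<And>y. y \<in> V \<Longrightarrow> y - T (g y) \<in> V" "\<And>y. y \<in> V \<Longrightarrow> norm (y - T (g y)) \<le> norm y / 2"
    using step by metis
  define e where "e = rec_nat y (\<lambda>_ z. z - T (g z))"
  have e0: "e 0 = y" and eS: "e (Suc k) = e k - T (g (e k))" for k by (simp_all add: e_def)
  have eV: "e k \<in> V" for k by (induction k) (simp_all add: e0 eS y g)
  have e_norm: "norm (e k) \<le> norm y * (1/2)^k" for k
  proof (induction k)
    case (Suc k)
    have "norm (e (Suc k)) \<le> norm (e k) / 2" unfolding eS by (rule g(3)[OF eV])
    also have "\<dots> \<le> norm y * (1/2)^k / 2" using Suc by simp
    finally show ?case by simp
  qed (simp add: e0)
  have x_norm: "norm (g (e k)) \<le> C * norm y * (1/2)^k" for k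
    using g(1)[OF eV[of k]] mult_left_mono[OF e_norm[of k] assms(2)] by (simp add: mult.assoc)
  have sum: "(\<lambda>k. C * norm y * (1/2)^k) sums (C * norm y * 2)"
    using sums_mult[OF geometric_sums[of "1/2 :: real"], of "C * norm y"] by simp
  have summ: "summable (\<lambda>k. g (e k))"
    using x_norm by (intro summable_comparison_test[OF _ sums_summable[OF sum]]) auto
  have partial: "T (\<Sum>k<n. g (e k)) = y - e n" for n
    by (induction n) (simp_all add: e0 eS linear_add[OF bounded_linear.linear[OF T]] linear_0[OF bounded_linear.linear[OF T]])
  have "e \<longlonglongrightarrow> 0"
  proof (rule Lim_null_comparison)
    show "\<forall>\<^sub>F k in sequentially. norm (e k) \<le> norm y * (1/2)^k" using e_norm by simp
    show "(\<lambda>k. norm y * (1/2)^k) \<longlonglongrightarrow> 0"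
      by (rule tendsto_mult_right_zero, rule LIMSEQ_realpow_zero) auto
  qed
  then have "(\<lambda>n. y - e n) \<longlonglongrightarrow> y - 0" by (intro tendsto_intros)
  moreover have "(\<lambda>n. T (\<Sum>k<n. g (e k))) \<longlonglongrightarrow> T (\<Sum>k. g (e k))"
    by (intro bounded_linear.tendsto[OF T] summable_LIMSEQ summ)
  ultimately have "T (\<Sum>k. g (e k)) = y"
    unfolding partial using LIMSEQ_unique by fastforce
  moreover have "norm (\<Sum>k. g (e k)) \<le> (\<Sum>k. C * norm y * (1/2)^k)"
    using x_norm sums_summable[OF sum] by (rule norm_suminf_le)
  ultimately show thesis using that sums_unique[OF sum] by (simp add: mult_ac)
qed

text \<open>
  By the Baire category theorem the closure of the image of some ball has an interior point. So
  every \<open>y\<close> is approximated, up to half its norm, by images of vectors of norm at most \<open>C * norm y\<close>, and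
  successive approximation removes the error.
\<close>

lemma open_mapping:
  fixes T :: "'a::banach \<Rightarrow> 'b::banach"
  assumes T: "bounded_linear T" and surj: "surj T"
  obtains C where "C > 0" "\<And>y. \<exists>x. T x = y \<and> norm x \<le> C * norm y"
proof -
  note lin = bounded_linear.linear[OF T]
  have "\<exists>N::nat. interior (closure (T ` cball 0 (real N))) \<noteq> {}"
  proof (rule ccontr)
    assume "\<not> ?thesis"
    then have empty: "interior (closure (T ` cball 0 (real N))) = {}" for N :: nat by blast
    have "euclidean interior_of \<Union>(range (\<lambda>N::nat. closure (T ` cball 0 (real N)))) = {}"
    proof (rule Baire_category_alt)
      show "completely_metrizable_space (euclidean :: 'b topology) \<or>
          locally_compact_space (euclidean :: 'b topology) \<and> regular_space (euclidean :: 'b topology)"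
        using completely_metrizable_space_euclidean by blast
      fix S assume "S \<in> range (\<lambda>N::nat. closure (T ` cball 0 (real N)))"
      then show "closedin euclidean S \<and> euclidean interior_of S = {}"
        using empty by auto
    qed simp
    moreover have "\<Union>(range (\<lambda>N::nat. closure (T ` cball 0 (real N)))) = UNIV"
    proof -
      have "y \<in> \<Union>(range (\<lambda>N::nat. closure (T ` cball 0 (real N))))" for y
      proof -
        obtain x where x: "y = T x" using surj by blast
        obtain N :: nat where "norm x \<le> real N" using real_arch_simple by blast
        then have "y \<in> T ` cball 0 (real N)" using x by auto
        then have "y \<in> closure (T ` cball 0 (real N))" by (rule subsetD[OF closure_subset])
        then show ?thesis by (rule UN_I[OF UNIV_I])
      qed
      then show ?thesis by (intro equalityI subset_UNIV subsetI)
    qed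
    ultimately show False by simp
  qed
  then obtain N :: nat and z e where e: "e > 0" "ball z e \<subseteq> closure (T ` cball 0 (real N))"
    by (meson ex_in_conv mem_interior)
  have approx: "\<exists>x. norm x \<le> real N \<and> norm (w - T x) < d" if w: "dist z w < e" and d: "d > 0" for w d
  proof -
    have "w \<in> closure (T ` cball 0 (real N))" using e(2) w by auto
    then obtain v where "v \<in> T ` cball 0 (real N)" "dist v w < d"
      using d unfolding closure_approachable by blast
    then show ?thesis by (auto simp: dist_norm norm_minus_commute)
  qed
  \<comment> \<open>two preimages of norm at most \<open>N\<close> serve a vector of norm \<open>e / 2\<close>; the summand \<open>1\<close> makes \<open>C\<close> positive when \<open>N = 0\<close>\<close>
  define C where "C = 4 * real N / e + 1"
  have C: "C > 0" unfolding C_def using e(1) by (simp add: add_nonneg_pos)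
  have step: "\<exists>x. norm x \<le> C * norm y \<and> y - T x \<in> UNIV \<and> norm (y - T x) \<le> norm y / 2" for y
  proof (cases "y = 0")
    case True
    then show ?thesis using linear_0[OF lin] by (intro exI[of _ 0]) auto
  next
    case False
    \<comment> \<open>the scaling that moves \<open>y\<close> into the ball of radius \<open>e\<close>\<close>
    define s where "s = e / (2 * norm y)"
    have s: "s > 0" unfolding s_def using False e(1) by simp
    have d: "s * norm y / 4 > 0" using s False by simp
    obtain u where u: "norm u \<le> real N" "norm ((z + s *\<^sub>R y) - T u) < s * norm y / 4"
      using approx[OF _ d, of "z + s *\<^sub>R y"] False e(1) s by (auto simp: dist_norm s_def)
    obtain v where v: "norm v \<le> real N" "norm (z - T v) < s * norm y / 4"
      using approx[OF _ d, of z] e(1) by auto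
    have "norm (((z + s *\<^sub>R y) - T u) - (z - T v)) \<le> s * norm y / 2"
      using norm_triangle_ineq4[of "(z + s *\<^sub>R y) - T u" "z - T v"] u(2) v(2) by linarith
    moreover have "((z + s *\<^sub>R y) - T u) - (z - T v) = s *\<^sub>R (y - T ((1/s) *\<^sub>R (u - v)))"
      using s by (simp add: linear_scale[OF lin] linear_diff[OF lin] scaleR_diff_right)
    ultimately have "s * norm (y - T ((1/s) *\<^sub>R (u - v))) \<le> s * (norm y / 2)"
      using s by (metis abs_of_pos norm_scaleR times_divide_eq_right)
    then have 1: "norm (y - T ((1/s) *\<^sub>R (u - v))) \<le> norm y / 2" using s by simp
    have "norm ((1/s) *\<^sub>R (u - v)) = (1/s) * norm (u - v)"
      using s unfolding norm_scaleR by simp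
    also have "\<dots> \<le> (1/s) * (2 * real N)"
      using norm_triangle_ineq4[of u v] u(1) v(1) s by (intro mult_left_mono) auto
    also have "\<dots> \<le> C * norm y" using False e(1) by (simp add: C_def s_def field_simps)
    finally show ?thesis using 1 by blast
  qed
  have "\<exists>x. T x = y \<and> norm x \<le> 2 * C * norm y" for y
    using successive_approximation[OF T less_imp_le[OF C] step UNIV_I, of y] by blast
  then show thesis using that[of "2 * C"] C by simp
qed

section \<open>Finite-dimensional subspaces\<close>

instance bcontfun :: (metric_space, banach) banach ..

text \<open>
  A linear combination of \<open>f 0, \<dots>, f (m - 1)\<close> whose coefficients are the values of a bounded
  continuous function at \<open>0, \<dots>, m - 1\<close>. In this way the coefficient vectors, for all \<open>m\<close> at once, live
  in one Banach space, and the open mapping theorem applies to \<open>(x, c) \<mapsto> T x + combination f m c\<close>.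
\<close>

definition combination :: "(nat \<Rightarrow> 'a::complex_normed_vector) \<Rightarrow> nat \<Rightarrow> (real \<Rightarrow>\<^sub>C complex) \<Rightarrow> 'a" where
  "combination f m c = (\<Sum>i<m. apply_bcontfun c (real i) *\<^sub>C f i)"

lemma norm_coord_le: "cmod (apply_bcontfun c i) \<le> norm c" for c :: "real \<Rightarrow>\<^sub>C complex"
  by (rule norm_bounded)

lemma bounded_linear_combination: "bounded_linear (combination f m)"
proof (rule bounded_linear_intro[where K="\<Sum>i<m. norm (f i)"])
  show "combination f m (c + d) = combination f m c + combination f m d" for c d
    by (simp add: combination_def plus_bcontfun.rep_eq scaleC_add_left sum.distrib)
  show "combination f m (r *\<^sub>R c) = r *\<^sub>R combination f m c" for r c
    by (simp add: combination_def scaleR_bcontfun.rep_eq scaleR_scaleC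
        scaleC_scaleC scaleR_conv_of_real complex_vector.scale_sum_right)
  show "norm (combination f m c) \<le> norm c * (\<Sum>i<m. norm (f i))" for c
    unfolding combination_def sum_distrib_left
    by (intro sum_norm_le) (auto simp: norm_scaleC intro!: mult_right_mono norm_coord_le)
qed

text \<open>
  Interpolation by hat functions centred at the integers.
\<close>

lemma bcontfun_with_coords:
  fixes a :: "nat \<Rightarrow> complex"
  shows "\<exists>c. (\<forall>i. apply_bcontfun c (real i) = (if i < m then a i else 0)) \<and> norm c \<le> (\<Sum>i<m. cmod (a i))"
proof -
  let ?g = "\<lambda>x. \<Sum>i<m. of_real (max 0 (1 - \<bar>x - real i\<bar>)) * a i"
  have le: "cmod (?g x) \<le> (\<Sum>i<m. cmod (a i))" for x
    by (intro sum_norm_le) (auto simp: norm_mult intro!: mult_left_le_one_le)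
  have "continuous_on UNIV ?g" by (intro continuous_intros)
  then have "?g \<in> bcontfun" using le by (rule bcontfun_normI)
  then obtain c where c: "?g = apply_bcontfun c" by (rule bcontfunE)
  have "apply_bcontfun c (real j) = (if j < m then a j else 0)" for j
  proof -
    have "max 0 (1 - \<bar>real j - real i\<bar>) = (if i = j then 1 else 0)" for i
    proof (cases "i = j")
      case False
      then have "\<bar>real j - real i\<bar> \<ge> 1" by linarith
      then show ?thesis using False by simp
    qed simp
    then have "?g (real j) = (\<Sum>i<m. if i = j then a i else 0)"
      by (intro sum.cong) auto
    also have "\<dots> = (if j < m then a j else 0)" by simp
    finally show ?thesis by (simp only: fun_cong[OF c, symmetric])
  qed
  moreover have "norm c \<le> (\<Sum>i<m. cmod (a i))"
    by (rule norm_bound) (simp only: fun_cong[OF c, symmetric] le)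
  ultimately show ?thesis by (intro exI[of _ c]) simp
qed

lemma combination_in_span: "combination f m c \<in> complex_vector.span (f ` {..<m})"
  unfolding combination_def
  by (intro complex_vector.span_sum complex_vector.span_scale complex_vector.span_base) auto

lemma span_is_combination:
  assumes "x \<in> complex_vector.span (f ` {..<m})"
  obtains c where "x = combination f m c"
proof -
  have "\<exists>a. x = (\<Sum>i<m. a i *\<^sub>C f i)"
    using assms
  proof (induction rule: complex_vector.span_induct_alt)
    case base
    show ?case by (intro exI[of _ "\<lambda>_. 0"]) simp
  next
    case (step c z y)
    then obtain a j where a: "y = (\<Sum>i<m. a i *\<^sub>C f i)" and j: "z = f j" "j < m" by auto
    have "c *\<^sub>C z + y = (\<Sum>i<m. (if i = j then c *\<^sub>C f i else 0) + a i *\<^sub>C f i)"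
      using j a by (simp add: sum.distrib)
    also have "\<dots> = (\<Sum>i<m. ((if i = j then c else 0) + a i) *\<^sub>C f i)"
      by (intro sum.cong) (auto simp: scaleC_add_left)
    finally show ?case by (rule exI[of _ "\<lambda>i. (if i = j then c else 0) + a i"])
  qed
  then obtain a where a: "x = (\<Sum>i<m. a i *\<^sub>C f i)" by blast
  obtain c where "\<forall>i. apply_bcontfun c (real i) = (if i < m then a i else 0)"
    using bcontfun_with_coords[of m a] by auto
  then have "x = combination f m c" using a by (simp add: combination_def)
  then show thesis by (rule that)
qed

text \<open>
  Induction on the spanning set. If \<open>b\<close> is not in the span \<open>V\<close> of the others, then \<open>V\<close> is closed, so \<open>b\<close>
  has a positive distance \<open>d\<close> from it. In \<open>v + c b\<close> the coefficient then satisfies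
  \<open>\<bar>c\<bar> d \<le> norm (v + c b)\<close>, which confines \<open>(v, c)\<close> to a compact set.
\<close>

lemma compact_span_Int_cball:
  fixes B :: "'a::complex_normed_vector set"
  assumes "finite B"
  shows "compact (complex_vector.span B \<inter> cball 0 R)"
  using assms
proof (induction arbitrary: R rule: finite_induct)
  case empty
  then show ?case by (cases "R \<ge> 0") auto
next
  case (insert b B)
  let ?V = "complex_vector.span B"
  have closed: "closed ?V"
    unfolding closed_sequential_limits
  proof (intro allI impI)
    fix x l assume x: "(\<forall>n. x n \<in> ?V) \<and> x \<longlonglongrightarrow> l"
    then obtain R where "\<And>n. norm (x n) \<le> R"
      using convergent_imp_Bseq[of x] unfolding convergent_def Bseq_def by blast
    then have "\<forall>n. x n \<in> ?V \<inter> cball 0 R" using x by auto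
    then have "l \<in> ?V \<inter> cball 0 R"
      using compact_imp_closed[OF insert.IH[of R]] x unfolding closed_sequential_limits by blast
    then show "l \<in> ?V" by blast
  qed
  show ?case
  proof (cases "b \<in> ?V")
    case True
    then show ?thesis using insert.IH by (simp add: complex_vector.span_redundant)
  next
    case False
    have "?V \<noteq> {}" using complex_vector.span_zero by blast
    then have d: "infdist b ?V > 0"
      using False closed infdist_pos_not_in_closed by blast
    define d where "d = infdist b ?V"
    have dpos: "d > 0" using d by (simp add: d_def)
    have lower: "cmod c * d \<le> norm (v + c *\<^sub>C b)" if v: "v \<in> ?V" for c v
    proof (cases "c = 0")
      case False
      have "- (inverse c *\<^sub>C v) \<in> ?V"
        using v by (intro complex_vector.span_neg complex_vector.span_scale)
      then have "d \<le> dist b (- (inverse c *\<^sub>C v))" unfolding d_def by (rule infdist_le)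
      then have "cmod c * d \<le> cmod c * norm (b + inverse c *\<^sub>C v)"
        by (simp add: dist_norm mult_left_mono)
      also have "\<dots> = norm (v + c *\<^sub>C b)"
        unfolding norm_scaleC[symmetric] using False
        by (simp add: scaleC_add_right scaleC_scaleC scaleC_one add.commute)
      finally show ?thesis .
    qed simp
    let ?S = "(\<lambda>(v, c). v + c *\<^sub>C b) ` ((?V \<inter> cball 0 (R + R / d * norm b)) \<times> cball 0 (R / d))"
    have bl: "bounded_linear (\<lambda>c. c *\<^sub>C b)"
      by (rule bounded_linear_intro[where K="norm b"])
        (auto simp: scaleC_add_left scaleR_scaleC scaleC_scaleC norm_scaleC scaleR_conv_of_real)
    have "continuous_on S (\<lambda>(v :: 'a, c). v + c *\<^sub>C b)" for S
      unfolding case_prod_unfold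
      by (intro continuous_on_add continuous_on_fst continuous_on_id continuous_on_snd
          bounded_linear.continuous_on[OF bl])
    then have "compact ?S"
      by (intro compact_continuous_image compact_Times insert.IH compact_cball)
    moreover have "complex_vector.span (insert b B) \<inter> cball 0 R = ?S \<inter> cball 0 R"
    proof (intro equalityI subsetI)
      fix x assume x: "x \<in> complex_vector.span (insert b B) \<inter> cball 0 R"
      then obtain c where c: "x - c *\<^sub>C b \<in> ?V" using complex_vector.span_breakdown_eq by blast
      have "cmod c * d \<le> R" using lower[OF c, of c] x by simp
      then have 1: "cmod c \<le> R / d" using dpos by (simp add: field_simps)
      have "norm (x - c *\<^sub>C b) \<le> norm x + cmod c * norm b"
        using norm_triangle_ineq4[of x "c *\<^sub>C b"] by (simp add: norm_scaleC)
      also have "\<dots> \<le> R + R / d * norm b"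
        using x 1 by (intro add_mono mult_right_mono) auto
      finally have "(x - c *\<^sub>C b, c) \<in> (?V \<inter> cball 0 (R + R / d * norm b)) \<times> cball 0 (R / d)"
        using c 1 by simp
      then have "(\<lambda>(v, c). v + c *\<^sub>C b) (x - c *\<^sub>C b, c) \<in> ?S" by (rule imageI)
      then show "x \<in> ?S \<inter> cball 0 R" using x by simp
    next
      fix x assume "x \<in> ?S \<inter> cball 0 R"
      then show "x \<in> complex_vector.span (insert b B) \<inter> cball 0 R"
        by (auto simp: complex_vector.span_breakdown_eq)
          (metis add_diff_cancel_right')
    qed
    ultimately show ?thesis by (simp add: compact_Int_closed)
  qed
qed

section \<open>The induced operator on the quotient\<close>

definition ess_lift :: "('a::complex_normed_vector \<Rightarrow> 'a) \<Rightarrow> 'a ess \<Rightarrow> 'a ess" where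
  "ess_lift T Y = abs_ess (\<lambda>n. T (rep_ess Y n))"

lemma ess_lift_abs:
  assumes "bounded_linear T" "bounded_seq x"
  shows "ess_lift T (abs_ess x) = abs_ess (\<lambda>n. T (x n))"
proof -
  have "ess_rel (rep_ess (abs_ess x)) x"
    using Quotient_rep_abs[OF Quotient_ess] assms(2) by (simp add: ess_rel_refl_iff)
  then have "ess_rel (\<lambda>n. T (rep_ess (abs_ess x) n)) (\<lambda>n. T (x n))"
    by (rule ess_rel_linear[OF assms(1)])
  then show ?thesis unfolding ess_lift_def by (simp add: ess_rel_def abs_ess_eq_iff)
qed

lemma scaleC_ess_abs: "bounded_seq x \<Longrightarrow> c *\<^sub>C abs_ess x = abs_ess (\<lambda>n. c *\<^sub>C x n)"
  by (simp add: scaleC_ess.abs_eq ess_rel_refl_iff)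

lemma bounded_clinear_ess_lift:
  assumes T: "bounded_clinear T"
  shows "bounded_clinear (ess_lift T)"
proof -
  have bl: "bounded_linear T" and sc: "\<And>c x. T (c *\<^sub>C x) = c *\<^sub>C T x"
    using T unfolding bounded_clinear_def by auto
  note lin = bounded_linear.linear[OF bl]
  note adm = bounded_seq_linear[OF bl] bounded_seq_linear[OF bounded_linear_scaleC] bounded_seq_add
  have add: "ess_lift T (X + Y) = ess_lift T X + ess_lift T Y" for X Y
  proof -
    obtain x where "X = abs_ess x" "bounded_seq x" by (rule ess_cases)
    moreover obtain y where "Y = abs_ess y" "bounded_seq y" by (rule ess_cases)
    ultimately show ?thesis by (simp add: plus_ess_abs ess_lift_abs[OF bl] adm linear_add[OF lin])
  qed
  have scale: "ess_lift T (c *\<^sub>C X) = c *\<^sub>C ess_lift T X" for c X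
  proof -
    obtain x where "X = abs_ess x" "bounded_seq x" by (rule ess_cases)
    then show ?thesis by (simp add: scaleC_ess_abs ess_lift_abs[OF bl] adm sc)
  qed
  obtain K where K: "K > 0" "\<And>x. norm (T x) \<le> norm x * K"
    using bounded_linear.pos_bounded[OF bl] by auto
  have "norm (ess_lift T X) \<le> norm X * K" for X
  proof -
    obtain x where x: "X = abs_ess x" "bounded_seq x" by (rule ess_cases)
    have "norm (T u - T v) \<le> K * norm (u - v)" for u v
      using K(2)[of "u - v"] by (simp add: linear_diff[OF lin] mult.commute)
    then have "covering_radius (\<lambda>n. T (x n)) \<le> K * covering_radius x"
      by (rule covering_radius_image_le[OF x(2) K(1)])
    then show ?thesis using x by (simp add: ess_lift_abs[OF bl] norm_ess_abs adm mult.commute)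
  qed
  then have "bounded_linear (ess_lift T)"
    by (intro bounded_linear_intro[where K=K]) (auto simp: add scale scaleR_scaleC)
  then show ?thesis using scale by (simp add: bounded_clinear_def)
qed

lemma ess_lift_pencil:
  assumes A: "bounded_clinear A"
  shows "ess_lift (\<lambda>x. \<mu> *\<^sub>C x - A x) = (\<lambda>X. \<mu> *\<^sub>C X - ess_lift A X)"
proof
  fix X :: "'a ess"
  have bl: "bounded_linear A" "bounded_linear (\<lambda>x. \<mu> *\<^sub>C x - A x)"
    using A clinear_pencil[OF A] unfolding bounded_clinear_def by auto
  obtain x where "X = abs_ess x" "bounded_seq x" by (rule ess_cases)
  then show "ess_lift (\<lambda>x. \<mu> *\<^sub>C x - A x) X = \<mu> *\<^sub>C X - ess_lift A X"
    by (simp add: ess_lift_abs[OF bl(1)] ess_lift_abs[OF bl(2)] scaleC_ess_abs minus_ess_abs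
        bounded_seq_linear[OF bl(1)] bounded_seq_linear[OF bounded_linear_scaleC])
qed

lemma totally_bounded_seq_if_in_compact:
  assumes "compact S" "\<And>n. x n \<in> S"
  shows "totally_bounded_seq x"
  unfolding totally_bounded_seq_def
proof (intro allI impI)
  fix r :: real assume "r > 0"
  then obtain F where F: "finite F" "S \<subseteq> (\<Union>f\<in>F. ball f r)"
    using assms(1) unfolding compact_eq_totally_bounded by blast
  show "covered r x"
  proof (rule coveredI[OF F(1)])
    fix n
    obtain f where "f \<in> F" "x n \<in> ball f r" using F(2) assms(2)[of n] by blast
    then show "\<exists>f\<in>F. norm (x n - f) \<le> r"
      by (intro bexI[of _ f]) (auto simp: dist_norm norm_minus_commute)
  qed
qed

lemma totally_bounded_seq_finite_range:
  assumes "finite F" "\<And>n. x n \<in> F"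
  shows "totally_bounded_seq x"
  using totally_bounded_seq_if_in_compact[OF finite_imp_compact[OF assms(1)] assms(2)] .

lemma totally_bounded_seq_bounded_in_span:
  assumes "finite B" "\<And>n. x n \<in> complex_vector.span B" "\<And>n. norm (x n) \<le> R"
  shows "totally_bounded_seq x"
  using compact_span_Int_cball[OF assms(1)] by (rule totally_bounded_seq_if_in_compact) (use assms in auto)

text \<open>
  Infinitely many members of the sequence share a ball of radius \<open>\<epsilon> / 2\<close>.
\<close>

lemma totally_bounded_seq_pigeonhole:
  fixes x :: "nat \<Rightarrow> 'a::real_normed_vector"
  assumes "totally_bounded_seq x" "\<epsilon> > 0"
  obtains m n where "N \<le> m" "m < n" "norm (x n - x m) \<le> \<epsilon>"
proof -
  have "covered (\<epsilon> / 2) x" using assms by (simp add: totally_bounded_seq_def)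
  then obtain F where F: "finite F" "\<forall>n. \<exists>f\<in>F. norm (x n - f) \<le> \<epsilon> / 2"
    unfolding covered_def by auto
  obtain f where f: "\<And>n. f n \<in> F" "\<And>n. norm (x n - f n) \<le> \<epsilon> / 2" using F(2) by metis
  have "\<not> inj_on f {N..}"
    using F(1) f(1) infinite_Ici[of N] finite_imageD[of f "{N..}"] finite_subset[of "f ` {N..}" F] by blast
  then obtain m n where mn: "N \<le> m" "N \<le> n" "m \<noteq> n" "f m = f n" unfolding inj_on_def by auto
  have close: "norm (x n - x m) \<le> \<epsilon>"
    using norm_triangle_ineq4[of "x n - f n" "x m - f m"] f(2)[of n] f(2)[of m] mn(4) by simp
  show thesis
  proof (cases "m < n")
    case True
    then show thesis using that mn(1) close by blast
  next
    case False
    then show thesis using that[of n m] mn close by (simp add: norm_minus_commute)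
  qed
qed

section \<open>Fredholm operators\<close>

text \<open>
  A spanning complement with the least number of vectors is independent modulo \<open>V\<close>: a vector with
  a nonzero coefficient in a combination from \<open>V\<close> could be omitted.
\<close>

lemma complement_of_finite_ccodim:
  fixes V :: "'a::complex_normed_vector set"
  assumes V: "complex_vector.subspace V" and "finite_ccodim V"
  obtains f and m :: nat where "\<And>y. \<exists>v\<in>V. \<exists>c. y = v + combination f m c"
    "\<And>c. combination f m c \<in> V \<Longrightarrow> combination f m c = 0"
proof -
  let ?P = "\<lambda>F. finite F \<and> complex_vector.span (V \<union> F) = UNIV"
  obtain F where F: "?P F" "\<And>G. ?P G \<Longrightarrow> card F \<le> card G"
    using assms(2) ex_has_least_nat[of ?P _ card] unfolding finite_ccodim_def by metis
  obtain f and m :: nat where f: "F = f ` {..<m}" "inj_on f {..<m}"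
    using finite_imp_nat_seg_image_inj_on[of F] F(1) by (auto simp: lessThan_def)
  have "\<exists>v\<in>V. \<exists>c. y = v + combination f m c" for y
  proof -
    have "y \<in> complex_vector.span (V \<union> F)" using F(1) by simp
    then obtain v w where vw: "v \<in> complex_vector.span V" "w \<in> complex_vector.span F" "y = v + w"
      unfolding complex_vector.span_Un by blast
    obtain c where "w = combination f m c" by (rule span_is_combination[OF vw(2)[unfolded f(1)]])
    then show ?thesis using vw complex_vector.span_eq_iff[THEN iffD2, OF V] by auto
  qed
  moreover have "combination f m c = 0" if c: "combination f m c \<in> V" for c
  proof -
    have "apply_bcontfun c (real i) = 0" if i: "i < m" for i
    proof (rule ccontr)
      assume ci: "apply_bcontfun c (real i) \<noteq> 0"
      let ?G = "F - {f i}"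
      let ?S = "complex_vector.span (V \<union> ?G)"
      have fi: "f i \<in> F" using f(1) i by auto
      have sub: "f j \<in> ?S" if "j \<in> {..<m} - {i}" for j
        using that f(1) inj_onD[OF f(2), of j i] i by (intro complex_vector.span_base) auto
      have "combination f m c = apply_bcontfun c (real i) *\<^sub>C f i + (\<Sum>j\<in>{..<m} - {i}. apply_bcontfun c (real j) *\<^sub>C f j)"
        unfolding combination_def using i by (intro sum.remove) auto
      then have eq: "apply_bcontfun c (real i) *\<^sub>C f i
          = combination f m c - (\<Sum>j\<in>{..<m} - {i}. apply_bcontfun c (real j) *\<^sub>C f j)" by simp
      have "apply_bcontfun c (real i) *\<^sub>C f i \<in> ?S"
        unfolding eq using c
        by (intro complex_vector.span_diff complex_vector.span_sum complex_vector.span_scale sub)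
          (auto intro: complex_vector.span_base)
      then have "inverse (apply_bcontfun c (real i)) *\<^sub>C apply_bcontfun c (real i) *\<^sub>C f i \<in> ?S"
        by (rule complex_vector.span_scale)
      then have "f i \<in> ?S" using ci by (simp add: scaleC_scaleC scaleC_one)
      then have "V \<union> F \<subseteq> ?S" by (auto intro: complex_vector.span_base)
      then have "complex_vector.span (V \<union> F) \<subseteq> ?S"
        by (rule complex_vector.span_minimal) (rule complex_vector.subspace_span)
      then have "?P ?G" using F(1) by auto
      then have "card F \<le> card ?G" by (rule F(2))
      moreover have "card ?G < card F" using F(1) fi by (intro card_Diff1_less) auto
      ultimately show False by simp
    qed
    then show ?thesis by (simp add: combination_def)
  qed
  ultimately show thesis using that by blast
qed

text \<open>
  If vectors of norm at most \<open>1\<close> in \<open>V\<close> are within \<open>1/2\<close> of \<open>T x + f\<close> with \<open>x\<close> bounded and \<open>f\<close> from a fixed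
  finite set, then successive approximation shows that \<open>range T\<close> and this set span \<open>V\<close>. Otherwise
  vectors far from everything reached so far can be chosen one after the other. The case \<open>T = 0\<close>
  concerns kernels, the case \<open>V = UNIV\<close> ranges.
\<close>

lemma finite_cover_or_separated:
  fixes T :: "'a::cbanach \<Rightarrow> 'a"
  assumes T: "bounded_linear T" and V: "complex_vector.subspace V" and TV: "\<And>x. T x \<in> V"
    and not_cov: "\<And>F. finite F \<Longrightarrow> F \<subseteq> V \<Longrightarrow> \<not> V \<subseteq> complex_vector.span (range T \<union> F)"
  shows "\<exists>y. \<forall>n::nat. y n \<in> V \<and> norm (y n) \<le> 1 \<and>
    (\<forall>m<n. \<forall>x. norm x \<le> real n \<longrightarrow> 1/2 < norm (y n - y m - T x))"
proof -
  have far: "\<exists>y. y \<in> V \<and> norm y \<le> 1 \<and> (\<forall>f\<in>F. \<forall>x. norm x \<le> C \<longrightarrow> 1/2 < norm (y - f - T x))"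
    if F: "finite F" "F \<subseteq> V" and "0 \<le> C" for F C
  proof (rule ccontr)
    assume "\<not> ?thesis"
    then have near: "\<exists>f\<in>F. \<exists>x. norm x \<le> C \<and> norm (y - f - T x) \<le> 1/2" if "y \<in> V" "norm y \<le> 1" for y
      using that by (meson not_le)
    obtain f and m :: nat where f: "F = f ` {..<m}"
      using finite_imp_nat_seg_image_inj_on[of F] F(1) by (auto simp: lessThan_def)
    define S where "S = (\<lambda>(x, c). T x + combination f m c)"
    have S: "bounded_linear S"
      unfolding S_def case_prod_unfold
      by (intro bounded_linear_add bounded_linear_compose[OF T] bounded_linear_fst
          bounded_linear_compose[OF bounded_linear_combination] bounded_linear_snd)
    have step: "\<exists>p. norm p \<le> (C + 1) * norm y \<and> y - S p \<in> V \<and> norm (y - S p) \<le> norm y / 2" if y: "y \<in> V" for y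
    proof (cases "y = 0")
      case True
      then show ?thesis using linear_0[OF bounded_linear.linear[OF S]] y by (intro exI[of _ 0]) auto
    next
      case False
      define u where "u = (1 / norm y) *\<^sub>R y"
      have "u \<in> V" unfolding u_def scaleR_scaleC using V y by (intro complex_vector.subspace_scale)
      moreover have "norm u \<le> 1" using False by (simp add: u_def)
      ultimately obtain g x where gx: "g \<in> F" "norm x \<le> C" "norm (u - g - T x) \<le> 1/2" using near by blast
      obtain i where i: "g = f i" "i < m" using gx(1) f by auto
      obtain c :: "real \<Rightarrow>\<^sub>C complex" where c: "\<forall>j. apply_bcontfun c (real j) = (if j < m then if j = i then 1 else 0 else 0)"
        "norm c \<le> (\<Sum>j<m. cmod (if j = i then 1 else 0))"
        using bcontfun_with_coords[of m "\<lambda>j. if j = i then 1 else 0"] by auto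
      have comb: "combination f m c = g"
      proof -
        have "combination f m c = (\<Sum>j<m. if j = i then f j else 0)"
          unfolding combination_def by (intro sum.cong) (auto simp: c(1) scaleC_one)
        then show ?thesis using i by simp
      qed
      have nc: "norm c \<le> 1"
      proof -
        have "(\<Sum>j<m. cmod (if j = i then 1 else 0)) = (\<Sum>j<m. if j = i then 1 else 0)"
          by (intro sum.cong) auto
        then show ?thesis using c(2) i(2) by simp
      qed
      define p where "p = norm y *\<^sub>R (x, c)"
      have Sp: "S p = norm y *\<^sub>R (T x + g)"
        unfolding p_def linear_scale[OF bounded_linear.linear[OF S]] by (simp add: S_def comb)
      have "norm p \<le> norm y * (norm x + norm c)"
        unfolding p_def norm_scaleR using norm_Pair_le[of x c] by (simp add: mult_left_mono)
      also have "\<dots> \<le> norm y * (C + 1)" using gx(2) nc by (intro mult_left_mono) auto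
      finally have 1: "norm p \<le> (C + 1) * norm y" by (simp add: mult.commute)
      have "S p \<in> V" unfolding Sp scaleR_scaleC using V TV gx(1) F(2)
        by (intro complex_vector.subspace_scale complex_vector.subspace_add) auto
      then have 2: "y - S p \<in> V" using V y by (intro complex_vector.subspace_diff)
      have "y - S p = norm y *\<^sub>R (u - g - T x)"
        using False by (simp add: Sp u_def scaleR_diff_right scaleR_add_right)
      then have "norm (y - S p) = norm y * norm (u - g - T x)" by simp
      also have "\<dots> \<le> norm y * (1/2)" using gx(3) by (intro mult_left_mono) auto
      finally have 3: "norm (y - S p) \<le> norm y / 2" by simp
      show ?thesis by (intro exI[of _ p] conjI 1 2 3)
    qed
    have C1: "0 \<le> C + 1" using \<open>0 \<le> C\<close> by simp
    have "y \<in> complex_vector.span (range T \<union> F)" if "y \<in> V" for y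
    proof -
      obtain p where "S p = y" using successive_approximation[OF S C1 step \<open>y \<in> V\<close>] by blast
      then have "y = T (fst p) + combination f m (snd p)" by (simp add: S_def case_prod_unfold)
      moreover have "T (fst p) \<in> complex_vector.span (range T \<union> F)"
        by (intro complex_vector.span_base) auto
      moreover have "combination f m (snd p) \<in> complex_vector.span (range T \<union> F)"
        using combination_in_span[of f m "snd p"] complex_vector.span_mono[of F "range T \<union> F"] f by auto
      ultimately show ?thesis by (simp add: complex_vector.span_add)
    qed
    then show False using not_cov[OF F] by blast
  qed
  let ?P = "\<lambda>(y :: nat \<Rightarrow> 'a) n r. r \<in> V \<and> norm r \<le> 1 \<and>
      (\<forall>m<n. \<forall>x. norm x \<le> real n \<longrightarrow> 1/2 < norm (r - y m - T x))"
  show ?thesis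
  proof (rule dependent_wellorder_choice[where P="?P"])
    show "?P f n r = ?P g n r" if "\<And>m. m < n \<Longrightarrow> f m = g m" for r f g n
      using that by simp
    show "\<exists>r. ?P f n r" if prev: "\<And>m. m < n \<Longrightarrow> ?P f m (f m)" for n f
    proof -
      have "f ` {..<n} \<subseteq> V" using prev by blast
      then obtain r where "r \<in> V" "norm r \<le> 1"
        "\<forall>g\<in>f ` {..<n}. \<forall>x. norm x \<le> real n \<longrightarrow> 1/2 < norm (r - g - T x)"
        using far[of "f ` {..<n}" "real n"] by auto
      then show ?thesis by (intro exI[of _ r]) auto
    qed
  qed
qed

lemma subspace_kernel: "complex_vector.subspace {x. T x = 0}" if "bounded_clinear T"
  using that unfolding bounded_clinear_def complex_vector.subspace_def
  by (auto simp: linear_0[OF bounded_linear.linear] linear_add[OF bounded_linear.linear])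

lemma subspace_range: "complex_vector.subspace (range T)" if T: "bounded_clinear T"
proof -
  have lin: "linear T" and sc: "T (c *\<^sub>C x) = c *\<^sub>C T x" for c x
    using T unfolding bounded_clinear_def by (auto intro: bounded_linear.linear)
  have "0 \<in> range T" using linear_0[OF lin] by (metis rangeI)
  moreover have "T x + T y \<in> range T" "c *\<^sub>C T x \<in> range T" for x y c
    by (metis linear_add[OF lin] rangeI, metis sc rangeI)
  ultimately show ?thesis unfolding complex_vector.subspace_def by blast
qed

lemma totally_bounded_seq_sum: "(\<And>i. i < m \<Longrightarrow> totally_bounded_seq (y i)) \<Longrightarrow> totally_bounded_seq (\<lambda>n. \<Sum>i<(m::nat). y i n)"
  by (induction m) (simp_all add: totally_bounded_seq_const totally_bounded_seq_add)

lemma totally_bounded_seq_combination: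
  assumes "\<And>n. norm (c n) \<le> R"
  shows "totally_bounded_seq (\<lambda>n. combination f m (c n))"
  unfolding combination_def
proof (rule totally_bounded_seq_sum)
  fix i
  have "apply_bcontfun (c n) (real i) \<in> cball 0 R" for n
    using norm_coord_le[of "c n" "real i"] assms[of n] by simp
  then have "totally_bounded_seq (\<lambda>n. apply_bcontfun (c n) (real i))"
    by (rule totally_bounded_seq_if_in_compact[OF compact_cball])
  moreover have "bounded_linear (\<lambda>z. z *\<^sub>C f i)"
    by (rule bounded_linear_intro[where K="norm (f i)"])
      (auto simp: scaleC_add_left scaleR_scaleC scaleC_scaleC norm_scaleC scaleR_conv_of_real)
  ultimately show "totally_bounded_seq (\<lambda>n. apply_bcontfun (c n) (real i) *\<^sub>C f i)"
    using totally_bounded_seq_linear by blast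
qed

text \<open>
  Adjoining a complement of the range makes \<open>T\<close> onto, and the open mapping theorem yields preimages
  with control of the norm. For surjectivity of the induced operator, solve \<open>T x\<^sub>n = y\<^sub>n\<close> up to bounded
  combinations of finitely many vectors. For the lower bound, if \<open>T x\<^sub>n\<close> is covered by finitely many
  \<open>r\<close>-balls, pick one index \<open>j\<close> for each ball that is hit; then \<open>T (x\<^sub>n - x\<^sub>j)\<close> has norm at most \<open>2 r\<close>
  and a preimage \<open>w\<^sub>n\<close> of norm at most \<open>2 C r\<close>, and \<open>x\<^sub>n - x\<^sub>j - w\<^sub>n\<close> is a bounded sequence in the
  finite-dimensional kernel.
\<close>

lemma fredholm_imp_ess_invertible:
  fixes T :: "'a::cbanach \<Rightarrow> 'a"
  assumes "fredholm T"
  shows "has_bounded_inverse (ess_lift T)"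
proof -
  have T: "bounded_clinear T" and ker: "finite_cdim {x. T x = 0}" and ran: "finite_ccodim (range T)"
    using assms unfolding fredholm_def by auto
  have bl: "bounded_linear T" using T unfolding bounded_clinear_def by blast
  note lin = bounded_linear.linear[OF bl]
  obtain B where B: "finite B" "complex_vector.span B = {x. T x = 0}"
    using ker unfolding finite_cdim_def by blast
  obtain f and m :: nat where f: "\<And>y. \<exists>v\<in>range T. \<exists>c. y = v + combination f m c"
    "\<And>c. combination f m c \<in> range T \<Longrightarrow> combination f m c = 0"
    using complement_of_finite_ccodim[OF subspace_range[OF T] ran] by blast
  define S where "S = (\<lambda>(x, c). T x + combination f m c)"
  have S: "bounded_linear S"
    unfolding S_def case_prod_unfold
    by (intro bounded_linear_add bounded_linear_compose[OF bl] bounded_linear_fst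
        bounded_linear_compose[OF bounded_linear_combination] bounded_linear_snd)
  have "surj S"
  proof -
    have "\<exists>p. S p = y" for y
    proof -
      obtain x c where "y = T x + combination f m c" using f(1)[of y] by blast
      then show ?thesis by (intro exI[of _ "(x, c)"]) (simp add: S_def)
    qed
    then show ?thesis by (metis surjI)
  qed
  then obtain C where C: "C > 0" "\<And>y. \<exists>p. S p = y \<and> norm p \<le> C * norm y"
    using open_mapping[OF S] by blast
  have "\<forall>y. \<exists>p. T (fst p) + combination f m (snd p) = y \<and> norm p \<le> C * norm y"
    using C(2) by (simp add: S_def case_prod_unfold)
  then obtain p where "\<forall>y. T (fst (p y)) + combination f m (snd (p y)) = y \<and> norm (p y) \<le> C * norm y"
    by (rule exE[OF choice])
  then have p: "T (fst (p y)) + combination f m (snd (p y)) = y"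
    "norm (fst (p y)) \<le> C * norm y" "norm (snd (p y)) \<le> C * norm y" for y
    using norm_fst_le[of "fst (p y)" "snd (p y)"] norm_snd_le[of "snd (p y)" "fst (p y)"]
    by (auto intro: order_trans)
  \<comment> \<open>for vectors of the range the complementary part vanishes\<close>
  have lift_range: "\<exists>x. T x = T z \<and> norm x \<le> C * norm (T z)" for z
  proof -
    obtain x c where xc: "T x + combination f m c = T z" "norm x \<le> C * norm (T z)"
      using p[of "T z"] by blast
    have "combination f m c = T (z - x)" using xc(1) by (simp add: linear_diff[OF lin] algebra_simps)
    then have "combination f m c = 0" using f(2)[of c] by simp
    then show ?thesis using xc by (intro exI[of _ x]) simp
  qed
  then have "\<forall>z. \<exists>x. T x = T z \<and> norm x \<le> C * norm (T z)" by blast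
  then obtain w' where w': "\<forall>z. T (w' z) = T z \<and> norm (w' z) \<le> C * norm (T z)"
    by (rule exE[OF choice])
  have "\<exists>X. ess_lift T X = Y" for Y
  proof -
    obtain y where y: "Y = abs_ess y" "bounded_seq y" by (rule ess_cases)
    then obtain M where M: "\<forall>n. norm (y n) \<le> M" unfolding bounded_seq_iff_bounded by auto
    define x c where "x n = fst (p (y n))" and "c n = snd (p (y n))" for n
    then have xc: "T (x n) + combination f m (c n) = y n"
      "norm (x n) \<le> C * norm (y n)" "norm (c n) \<le> C * norm (y n)" for n
      using p[of "y n"] by simp_all
    have le: "C * norm (y n) \<le> C * M" for n using M C(1) by simp
    have xadm: "bounded_seq x"
      by (rule bounded_seqI[of _ "C * M"]) (rule order_trans[OF xc(2) le])
    have "totally_bounded_seq (\<lambda>n. combination f m (c n))"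
      by (rule totally_bounded_seq_combination[of _ "C * M"]) (rule order_trans[OF xc(3) le])
    moreover have "y n - T (x n) = combination f m (c n)" for n using xc(1)[of n] by (simp add: algebra_simps)
    ultimately have "totally_bounded_seq (\<lambda>n. y n - T (x n))" by simp
    then have "abs_ess y = abs_ess (\<lambda>n. T (x n))"
      using y(2) bounded_seq_linear[OF bl xadm] by (simp add: abs_ess_eq_iff)
    then show ?thesis using ess_lift_abs[OF bl xadm] y(1) by metis
  qed
  then have surj: "surj (ess_lift T)" by (metis surjI)
  have "norm X \<le> 2 * C * norm (ess_lift T X)" for X
  proof (rule field_le_epsilon)
    fix \<epsilon> :: real assume \<epsilon>: "\<epsilon> > 0"
    obtain x where x: "X = abs_ess x" "bounded_seq x" by (rule ess_cases)
    obtain M where M: "\<forall>n. norm (x n) \<le> M" using x(2) unfolding bounded_seq_iff_bounded by auto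
    define r where "r = norm (ess_lift T X) + \<epsilon> / (2 * C)"
    have "covered r (\<lambda>n. T (x n))"
    proof (rule covered_if_covering_radius_less)
      show "bounded_seq (\<lambda>n. T (x n))" by (rule bounded_seq_linear[OF bl x(2)])
      then show "covering_radius (\<lambda>n. T (x n)) < r"
        unfolding r_def using \<epsilon> C(1) x by (simp add: ess_lift_abs[OF bl] norm_ess_abs)
    qed
    then obtain F where F: "finite F" "\<forall>n. \<exists>g\<in>F. norm (T (x n) - g) \<le> r"
      unfolding covered_def by auto
    obtain g where g: "\<And>n. g n \<in> F" "\<And>n. norm (T (x n) - g n) \<le> r" using F(2) by metis
    \<comment> \<open>the representative of the ball that contains \<open>T (x n)\<close>\<close>
    define j where "j n = (LEAST k. g k = g n)" for n
    have gj: "g (j n) = g n" for n unfolding j_def by (rule LeastI) simp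
    have j_eq: "j n = (\<lambda>h. LEAST k. g k = h) (g n)" for n by (simp add: j_def)
    have "totally_bounded_seq (\<lambda>n. x (j n))"
    proof (rule totally_bounded_seq_finite_range)
      show "finite ((\<lambda>h. x (LEAST k. g k = h)) ` F)" using F(1) by simp
      show "x (j n) \<in> (\<lambda>h. x (LEAST k. g k = h)) ` F" for n
        using g(1)[of n] unfolding j_def by blast
    qed
    define w where "w n = w' (x n - x (j n))" for n
    have w: "T (w n) = T (x n - x (j n))" "norm (w n) \<le> C * norm (T (x n - x (j n)))" for n
      using w' by (simp_all add: w_def)
    have w_le: "norm (w n) \<le> 2 * C * r" for n
    proof -
      have "norm (T (x n - x (j n))) \<le> r + r"
        using norm_triangle_ineq4[of "T (x n) - g n" "T (x (j n)) - g (j n)"] g(2)[of n] g(2)[of "j n"]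
        by (simp add: gj linear_diff[OF lin])
      then have "C * norm (T (x n - x (j n))) \<le> C * (r + r)" using C(1) by simp
      then show ?thesis using w(2)[of n] by simp
    qed
    have "totally_bounded_seq (\<lambda>n. x n - x (j n) - w n)"
    proof (rule totally_bounded_seq_bounded_in_span[OF B(1)])
      show "x n - x (j n) - w n \<in> complex_vector.span B" for n
        unfolding B(2) using w(1)[of n] by (simp add: linear_diff[OF lin])
      show "norm (x n - x (j n) - w n) \<le> M + M + 2 * C * r" for n
        using norm_triangle_ineq4[of "x n - x (j n)" "w n"] norm_triangle_ineq4[of "x n" "x (j n)"]
          M[rule_format, of n] M[rule_format, of "j n"] w_le[of n] by linarith
    qed
    then have "totally_bounded_seq (\<lambda>n. (x n - x (j n) - w n) + x (j n))"
      using \<open>totally_bounded_seq (\<lambda>n. x (j n))\<close> by (rule totally_bounded_seq_add)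
    then have "totally_bounded_seq (\<lambda>n. x n - w n)" by (simp add: algebra_simps)
    moreover have "bounded_seq w" using w_le by (rule bounded_seqI)
    ultimately have "X = abs_ess w" using x by (simp add: abs_ess_eq_iff)
    then have "norm X \<le> 2 * C * r" using norm_ess_le[of w, OF w_le] by simp
    then show "norm X \<le> 2 * C * norm (ess_lift T X) + \<epsilon>"
    proof -
      have "2 * C * r = 2 * C * norm (ess_lift T X) + \<epsilon>"
        unfolding r_def using C(1) by (simp add: distrib_left)
      then show ?thesis using \<open>norm X \<le> 2 * C * r\<close> by simp
    qed
  qed
  then have "1 / (2 * C) * norm X \<le> norm (ess_lift T X)" for X
    using C(1) by (simp add: field_simps)
  then show ?thesis
    unfolding has_bounded_inverse_def using surj C(1)
    by (intro conjI exI[of _ "1 / (2 * C)"]) auto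
qed

text \<open>
  If the kernel were infinite-dimensional it would contain a bounded sequence of vectors at mutual
  distance more than \<open>1/2\<close>, whose class is nonzero and is mapped to \<open>0\<close>. If the range had infinite codimension, there
  would be a bounded sequence \<open>y\<close> of vectors whose differences stay away from the images of balls; but \<open>y\<^sub>n - T x\<^sub>n\<close>
  is totally bounded for some bounded \<open>x\<close>, which brings \<open>y\<^sub>n - y\<^sub>m\<close> near \<open>T (x\<^sub>n - x\<^sub>m)\<close> for some large
  \<open>m < n\<close>.
\<close>

lemma ess_invertible_imp_fredholm:
  fixes T :: "'a::cbanach \<Rightarrow> 'a"
  assumes T: "bounded_clinear T" and inv: "has_bounded_inverse (ess_lift T)"
  shows "fredholm T"
proof -
  have bl: "bounded_linear T" using T unfolding bounded_clinear_def by blast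
  note lin = bounded_linear.linear[OF bl]
  obtain c where surj: "surj (ess_lift T)" and c: "c > 0" "\<And>X. c * norm X \<le> norm (ess_lift T X)"
    using inv unfolding has_bounded_inverse_def by blast
  have "\<exists>F. finite F \<and> F \<subseteq> {x. T x = 0} \<and> {x. T x = 0} \<subseteq> complex_vector.span (range (\<lambda>x :: 'a. 0 :: 'a) \<union> F)"
  proof (rule ccontr)
    assume no: "\<not> ?thesis"
    have "\<exists>y. \<forall>n::nat. y n \<in> {x. T x = 0} \<and> norm (y n) \<le> 1 \<and>
        (\<forall>m<n. \<forall>x :: 'a. norm x \<le> real n \<longrightarrow> 1/2 < norm (y n - y m - 0))"
    proof (rule finite_cover_or_separated)
      show "bounded_linear (\<lambda>x :: 'a. 0 :: 'a)" by (rule bounded_linear_zero)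
      show "complex_vector.subspace {x. T x = 0}" by (rule subspace_kernel[OF T])
      show "0 \<in> {x. T x = 0}" using linear_0[OF lin] by simp
      show "\<not> {x. T x = 0} \<subseteq> complex_vector.span (range (\<lambda>x :: 'a. 0 :: 'a) \<union> F)"
        if "finite F" "F \<subseteq> {x. T x = 0}" for F
      proof
        assume "{x. T x = 0} \<subseteq> complex_vector.span (range (\<lambda>x :: 'a. 0 :: 'a) \<union> F)"
        then have "\<exists>F. finite F \<and> F \<subseteq> {x. T x = 0} \<and> {x. T x = 0} \<subseteq> complex_vector.span (range (\<lambda>x :: 'a. 0 :: 'a) \<union> F)"
          using that by (intro exI[of _ F] conjI)
        with no show False by (rule notE)
      qed
    qed
    then obtain y where y: "\<forall>n::nat. y n \<in> {x. T x = 0} \<and> norm (y n) \<le> 1 \<and>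
        (\<forall>m<n. \<forall>x :: 'a. norm x \<le> real n \<longrightarrow> 1/2 < norm (y n - y m - 0))" by (rule exE)
    have yadm: "bounded_seq y" by (rule bounded_seqI[of y 1]) (use y in blast)
    have "ess_lift T (abs_ess y) = abs_ess (\<lambda>n. 0)"
      using ess_lift_abs[OF bl yadm] y by simp
    then have "norm (ess_lift T (abs_ess y)) \<le> 0" using norm_ess_le[of "\<lambda>_. 0" 0] by simp
    then have "c * norm (abs_ess y) \<le> 0" using c(2) order_trans by blast
    then have "norm (abs_ess y) = 0" using c(1) by (simp add: mult_le_0_iff)
    then have "totally_bounded_seq y" using yadm by (simp add: norm_ess_abs covering_radius_zero_iff)
    then obtain m n where "m < n" "norm (y n - y m) \<le> 1/2"
      by (rule totally_bounded_seq_pigeonhole[of y "1/2" 0]) auto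
    moreover have "1/2 < norm (y n - y m - 0)"
      using y[rule_format, of n] \<open>m < n\<close> norm_zero[where 'a='a] of_nat_0_le_iff[of n] by metis
    ultimately show False by simp
  qed
  then obtain F where F: "finite F" "F \<subseteq> {x. T x = 0}"
    "{x. T x = 0} \<subseteq> complex_vector.span (range (\<lambda>x :: 'a. 0 :: 'a) \<union> F)" by blast
  have "range (\<lambda>x :: 'a. 0 :: 'a) \<union> F = insert 0 F" by auto
  then have "{x. T x = 0} \<subseteq> complex_vector.span F" using F(3) by (simp add: complex_vector.span_insert_0)
  moreover have "complex_vector.span F \<subseteq> {x. T x = 0}"
    using F(2) subspace_kernel[OF T] by (rule complex_vector.span_minimal)
  ultimately have ker: "finite_cdim {x. T x = 0}" unfolding finite_cdim_def using F(1) by blast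
  have "\<exists>F. finite F \<and> UNIV \<subseteq> complex_vector.span (range T \<union> F)"
  proof (rule ccontr)
    assume no: "\<not> ?thesis"
    have "\<exists>y. \<forall>n::nat. y n \<in> UNIV \<and> norm (y n) \<le> 1 \<and>
        (\<forall>m<n. \<forall>x. norm x \<le> real n \<longrightarrow> 1/2 < norm (y n - y m - T x))"
      by (rule finite_cover_or_separated[OF bl]) (use no in auto)
    then obtain y where y: "\<forall>n::nat. y n \<in> UNIV \<and> norm (y n) \<le> 1 \<and>
        (\<forall>m<n. \<forall>x. norm x \<le> real n \<longrightarrow> 1/2 < norm (y n - y m - T x))" by (rule exE)
    have yadm: "bounded_seq y" by (rule bounded_seqI[of y 1]) (use y in blast)
    obtain X where X: "ess_lift T X = abs_ess y" using surj by (metis surjD)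
    obtain x where x: "X = abs_ess x" "bounded_seq x" by (rule ess_cases)
    obtain M where M: "\<forall>n. norm (x n) \<le> M" using x(2) unfolding bounded_seq_iff_bounded by auto
    have "abs_ess y = abs_ess (\<lambda>n. T (x n))" using X x ess_lift_abs[OF bl] by simp
    then have "totally_bounded_seq (\<lambda>n. y n - T (x n))"
      using yadm bounded_seq_linear[OF bl x(2)] by (simp add: abs_ess_eq_iff)
    moreover obtain N :: nat where N: "2 * M \<le> real N" using real_arch_simple by blast
    ultimately obtain m n where mn: "N \<le> m" "m < n"
      "norm ((y n - T (x n)) - (y m - T (x m))) \<le> 1/2"
      by - (rule totally_bounded_seq_pigeonhole[of _ "1/2" N], auto)
    have "norm (x n - x m) \<le> real n"
      using norm_triangle_ineq4[of "x n" "x m"] M[rule_format, of n] M[rule_format, of m] N mn(1,2) by linarith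
    then have "1/2 < norm (y n - y m - T (x n - x m))" using y mn(2) by blast
    moreover have eq: "(y n - T (x n)) - (y m - T (x m)) = y n - y m - T (x n - x m)"
      unfolding linear_diff[OF lin] by (simp add: algebra_simps)
    ultimately show False using mn(3) unfolding eq by linarith
  qed
  then have "finite_ccodim (range T)" unfolding finite_ccodim_def by blast
  then show ?thesis using T ker by (simp add: fredholm_def)
qed

theorem essential_spectrum_eq_op_spectrum:
  fixes A :: "'a::cbanach \<Rightarrow> 'a"
  assumes "bounded_clinear A"
  shows "essential_spectrum A = op_spectrum (ess_lift A)"
  unfolding essential_spectrum_def op_spectrum_def ess_lift_pencil[OF assms, symmetric]
  using fredholm_imp_ess_invertible ess_invertible_imp_fredholm[OF clinear_pencil[OF assms]] by blast

section \<open>Approximate eigenvectors at the essential spectral radius\<close>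

text \<open>
  If the quotient is trivial, every operator on it is invertible, so \<open>0\<close> is Fredholm and its
  kernel, the whole space, is finite-dimensional.
\<close>

lemma ess_nontrivial:
  assumes "\<not> finite_cdim (UNIV :: 'a::cbanach set)"
  obtains X :: "'a::cbanach ess" where "X \<noteq> 0"
proof -
  have "\<exists>X :: 'a ess. X \<noteq> 0"
  proof (rule ccontr)
    assume "\<not> ?thesis"
    then have zero: "X = 0" for X :: "'a ess" by blast
    have "has_bounded_inverse (ess_lift (\<lambda>x :: 'a. 0 :: 'a))"
      unfolding has_bounded_inverse_def
    proof (intro conjI exI[of _ 1] allI)
      have "X = ess_lift (\<lambda>x :: 'a. 0 :: 'a) 0" for X using zero by metis
      then show "surj (ess_lift (\<lambda>x :: 'a. 0 :: 'a))" by (rule surjI[of _ "\<lambda>_. 0", OF sym])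
      show "1 * norm X \<le> norm (ess_lift (\<lambda>x :: 'a. 0 :: 'a) X)" for X
        using zero[of X] by simp
    qed simp
    moreover have "bounded_clinear (\<lambda>x :: 'a. 0 :: 'a)"
      unfolding bounded_clinear_def by (simp add: bounded_linear_zero)
    ultimately have "fredholm (\<lambda>x :: 'a. 0 :: 'a)" by (intro ess_invertible_imp_fredholm)
    then show False using assms by (simp add: fredholm_def)
  qed
  then show thesis using that by blast
qed

lemma essential_spectral_radius_attained:
  fixes A :: "'a::cbanach \<Rightarrow> 'a"
  assumes inf: "\<not> finite_cdim (UNIV :: 'a set)" and A: "bounded_clinear A"
  obtains \<mu> where "cmod \<mu> = essential_spectral_radius A" "\<mu> \<in> op_spectrum (ess_lift A)"
    "\<forall>\<nu>\<in>op_spectrum (ess_lift A). cmod \<nu> \<le> cmod \<mu>"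
proof -
  obtain X :: "'a ess" where "X \<noteq> 0" using ess_nontrivial[OF inf] .
  then obtain \<mu> where \<mu>: "\<mu> \<in> op_spectrum (ess_lift A)"
    "\<And>\<nu>. \<nu> \<in> op_spectrum (ess_lift A) \<Longrightarrow> cmod \<nu> \<le> cmod \<mu>"
    using op_spectrum_max_modulus[OF bounded_clinear_ess_lift[OF A]] by blast
  have "essential_spectral_radius A = cmod \<mu>"
    unfolding essential_spectral_radius_def essential_spectrum_eq_op_spectrum[OF A]
    by (rule Greatest_equality) (use \<mu> in auto)
  then show thesis using that \<mu> by auto
qed

text \<open>
  A labelling with finitely many labels is a finite partition of the index set; it can be refined
  to suit several sequences at once.
\<close>

definition labelled :: "real \<Rightarrow> (nat \<Rightarrow> nat) \<Rightarrow> (nat \<Rightarrow> 'a::real_normed_vector) \<Rightarrow> bool" where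
  "labelled r p z \<longleftrightarrow> (\<forall>m n. p m = p n \<longrightarrow> norm (z m - z n) \<le> r)"

lemma covered_imp_labelled:
  assumes "covered r z"
  shows "\<exists>p. finite (range p) \<and> labelled (2 * r) p z"
proof -
  obtain F where F: "finite F" "\<forall>n. \<exists>f\<in>F. norm (z n - f) \<le> r"
    using assms unfolding covered_def by auto
  obtain g where g: "\<And>n. g n \<in> F" "\<And>n. norm (z n - g n) \<le> r" using F(2) by metis
  define p where "p n = (LEAST k. g k = g n)" for n
  have gp: "g (p n) = g n" for n unfolding p_def by (rule LeastI) simp
  have "range p \<subseteq> (\<lambda>h. LEAST k. g k = h) ` F" using g(1) unfolding p_def by blast
  then have "finite (range p)" using F(1) by (meson finite_imageI finite_subset)
  moreover have "norm (z m - z n) \<le> 2 * r" if "p m = p n" for m n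
  proof -
    have "g m = g n" using gp[of m] gp[of n] that by simp
    then show ?thesis
      using norm_triangle_ineq4[of "z m - g m" "z n - g n"] g(2)[of m] g(2)[of n] by simp
  qed
  ultimately show ?thesis unfolding labelled_def by blast
qed

lemma common_labelling:
  fixes p q :: "nat \<Rightarrow> nat"
  assumes "finite (range p)" "finite (range q)"
  shows "\<exists>l :: nat \<Rightarrow> nat. finite (range l) \<and> (\<forall>m n. l m = l n \<longrightarrow> p m = p n \<and> q m = q n)"
proof -
  define l where "l n = prod_encode (p n, q n)" for n
  have "range l \<subseteq> prod_encode ` (range p \<times> range q)" unfolding l_def by auto
  moreover have "finite (prod_encode ` (range p \<times> range q))" using assms by simp
  ultimately have "finite (range l)" by (rule finite_subset)
  moreover have "\<forall>m n. l m = l n \<longrightarrow> p m = p n \<and> q m = q n" by (simp add: l_def)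
  ultimately show ?thesis by blast
qed

lemma labelled_functionals:
  fixes x :: "nat \<Rightarrow> 'a::real_normed_vector" and \<Phi> :: "('a \<Rightarrow> real) set"
  assumes "finite \<Phi>" "\<forall>\<phi>\<in>\<Phi>. bounded_linear \<phi>" "bounded_seq x" "r > 0"
  shows "\<exists>p. finite (range p) \<and> (\<forall>\<phi>\<in>\<Phi>. labelled r p (\<lambda>n. \<phi> (x n)))"
  using assms(1,2)
proof (induction rule: finite_induct)
  case empty
  show ?case by (intro exI[of _ "\<lambda>_. 0"]) simp
next
  case (insert \<phi> \<Phi>)
  obtain p where p: "finite (range p)" "\<forall>\<phi>\<in>\<Phi>. labelled r p (\<lambda>n. \<phi> (x n))"
    using insert by auto
  have "bounded_seq (\<lambda>n. \<phi> (x n))"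
    using bounded_seq_linear[of \<phi> x] insert.prems assms(3) by simp
  then obtain M where "\<forall>n. norm (\<phi> (x n)) \<le> M" unfolding bounded_seq_iff_bounded by auto
  then have "totally_bounded_seq (\<lambda>n. \<phi> (x n))"
    by (intro totally_bounded_seq_if_in_compact[OF compact_cball[of 0 M]]) simp
  then have "covered (r / 2) (\<lambda>n. \<phi> (x n))" using assms(4) by (simp add: totally_bounded_seq_def)
  then obtain q where q: "finite (range q)" "labelled r q (\<lambda>n. \<phi> (x n))"
    using covered_imp_labelled by fastforce
  obtain l :: "nat \<Rightarrow> nat" where l: "finite (range l)" "\<forall>m n. l m = l n \<longrightarrow> p m = p n \<and> q m = q n"
    using common_labelling[OF p(1) q(1)] by blast
  have "labelled r l (\<lambda>n. \<psi> (x n))" if "\<psi> \<in> insert \<phi> \<Phi>" for \<psi>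
    using that p(2) q(2) l(2) unfolding labelled_def by blast
  then show ?case using l(1) by blast
qed

text \<open>
  Represent an approximate eigenvector \<open>X\<close> of the induced operator by a sequence \<open>x\<close>, and partition the
  indices into finitely many classes on which \<open>\<mu> x\<^sub>n - A x\<^sub>n\<close> and all \<open>\<phi> (x\<^sub>n)\<close> vary little. Since \<open>x\<close> is
  not covered by finitely many balls of radius \<open>norm X / 2\<close>, some class contains two members of \<open>x\<close> at
  distance more than \<open>norm X / 2\<close>; their difference, normalised, is the vector \<open>u\<close>.
\<close>

lemma weakly_small_approximate_eigenvector:
  fixes A :: "'a::cbanach \<Rightarrow> 'a" and \<Phi> :: "('a \<Rightarrow> real) set"
  assumes A: "bounded_clinear A" and \<mu>: "\<mu> \<in> op_spectrum (ess_lift A)"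
    and max: "\<forall>\<nu>\<in>op_spectrum (ess_lift A). cmod \<nu> \<le> cmod \<mu>"
    and \<Phi>: "finite \<Phi>" "\<forall>\<phi>\<in>\<Phi>. bounded_linear \<phi>" and "\<epsilon> > 0"
  shows "\<exists>u. norm u = 1 \<and> norm (A u - \<mu> *\<^sub>C u) \<le> \<epsilon> \<and> (\<forall>\<phi>\<in>\<Phi>. \<bar>\<phi> u\<bar> \<le> \<epsilon>)"
proof -
  define T where "T x = \<mu> *\<^sub>C x - A x" for x
  have T: "bounded_linear T"
    using clinear_pencil[OF A] unfolding bounded_clinear_def T_def by blast
  note lin = bounded_linear.linear[OF T]
  obtain X where X: "norm (\<mu> *\<^sub>C X - ess_lift A X) < (\<epsilon> / 4) * norm X"
    using approximate_eigenvector[OF bounded_clinear_ess_lift[OF A] \<mu>, of "\<epsilon> / 4"] max assms(6) by auto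
  obtain x where x: "X = abs_ess x" "bounded_seq x" by (rule ess_cases)
  have D: "norm X > 0" using X by (cases "X = 0") (auto dest: order.strict_trans1[OF norm_ge_zero])
  have "norm (abs_ess (\<lambda>n. T (x n))) < (\<epsilon> / 4) * norm X"
    using X fun_cong[OF ess_lift_pencil[OF A, of \<mu>], of X] x ess_lift_abs[OF T x(2)]
    unfolding T_def by simp
  then have "covered ((\<epsilon> / 4) * norm X) (\<lambda>n. T (x n))"
    using bounded_seq_linear[OF T x(2)]
    by (intro covered_if_covering_radius_less) (simp_all add: norm_ess_abs)
  then obtain p where p: "finite (range p)" "labelled (2 * ((\<epsilon> / 4) * norm X)) p (\<lambda>n. T (x n))"
    using covered_imp_labelled by blast
  have e: "\<epsilon> / 2 * norm X > 0" using D assms(6) by simp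
  obtain q where q: "finite (range q)" "\<forall>\<phi>\<in>\<Phi>. labelled (\<epsilon> / 2 * norm X) q (\<lambda>n. \<phi> (x n))"
    using labelled_functionals[OF \<Phi> x(2) e] by blast
  obtain l :: "nat \<Rightarrow> nat" where l: "finite (range l)" "\<forall>m n. l m = l n \<longrightarrow> p m = p n \<and> q m = q n"
    using common_labelling[OF p(1) q(1)] by blast
  define j where "j n = (LEAST k. l k = l n)" for n
  have lj: "l (j n) = l n" for n unfolding j_def by (rule LeastI) simp
  have xj: "totally_bounded_seq (\<lambda>n. x (j n))"
  proof (rule totally_bounded_seq_finite_range)
    show "finite ((\<lambda>h. x (LEAST k. l k = h)) ` range l)" using l(1) by simp
    show "x (j n) \<in> (\<lambda>h. x (LEAST k. l k = h)) ` range l" for n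
      unfolding j_def by blast
  qed
  have "\<exists>n. norm X / 2 < norm (x n - x (j n))"
  proof (rule ccontr)
    assume "\<not> ?thesis"
    then have le: "norm (x n - x (j n)) \<le> norm X / 2" for n by (meson not_le)
    have "X = abs_ess (\<lambda>n. x n - x (j n))"
      using xj x bounded_seqI[of "\<lambda>n. x n - x (j n)", OF le] by (simp add: abs_ess_eq_iff)
    then have "norm X \<le> norm X / 2" using norm_ess_le[of "\<lambda>n. x n - x (j n)", OF le] by metis
    then show False using D by simp
  qed
  then obtain n where n: "norm X / 2 < norm (x n - x (j n))" by blast
  define v where "v = x n - x (j n)"
  have vpos: "norm v > 0" "norm X \<le> 2 * norm v" using n D unfolding v_def by linarith+
  have \<epsilon>v: "\<epsilon> / 2 * norm X \<le> \<epsilon> * norm v" using vpos(2) assms(6) by simp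
  have "norm (T (x n) - T (x (j n))) \<le> 2 * ((\<epsilon> / 4) * norm X)"
    using p(2) l(2)[rule_format, OF lj[of n]] unfolding labelled_def by metis
  then have Tv: "norm (T v) \<le> \<epsilon> * norm v" using \<epsilon>v by (simp add: v_def linear_diff[OF lin])
  have \<phi>v: "\<bar>\<phi> v\<bar> \<le> \<epsilon> * norm v" if "\<phi> \<in> \<Phi>" for \<phi>
  proof -
    have "norm (\<phi> (x n) - \<phi> (x (j n))) \<le> \<epsilon> / 2 * norm X"
      using q(2) that l(2)[rule_format, OF lj[of n]] unfolding labelled_def by metis
    then show ?thesis
      using \<epsilon>v linear_diff[OF bounded_linear.linear[OF \<Phi>(2)[rule_format, OF that]], of "x n" "x (j n)"]
      by (simp add: v_def)
  qed
  define u where "u = (1 / norm v) *\<^sub>R v"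
  have "norm u = 1" using vpos by (simp add: u_def)
  moreover have "norm (T u) \<le> \<epsilon>"
    using Tv vpos by (simp add: u_def linear_scale[OF lin] field_simps)
  then have "norm (A u - \<mu> *\<^sub>C u) \<le> \<epsilon>" unfolding T_def by (simp add: norm_minus_commute)
  moreover have "\<bar>\<phi> u\<bar> \<le> \<epsilon>" if "\<phi> \<in> \<Phi>" for \<phi>
    using \<phi>v[OF that] vpos linear_scale[OF bounded_linear.linear[OF \<Phi>(2)[rule_format, OF that]]]
    by (simp add: u_def abs_mult field_simps)
  ultimately show ?thesis by blast
qed

section \<open>Construction of the initial vector\<close>

text \<open>
  Functionals norming for the centres of a finite net of mesh \<open>\<delta> / 2\<close>.
\<close>

lemma norming_functionals_compact:
  fixes W :: "'a::real_normed_vector set"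
  assumes "compact W" "\<delta> > 0"
  shows "\<exists>\<Theta> :: ('a \<Rightarrow> real) set. finite \<Theta> \<and> (\<forall>\<theta>\<in>\<Theta>. bounded_linear \<theta> \<and> (\<forall>x. \<bar>\<theta> x\<bar> \<le> norm x)) \<and>
    (\<forall>w\<in>W. \<exists>\<theta>\<in>\<Theta>. norm w - \<delta> \<le> \<theta> w)"
proof -
  have "\<forall>w. \<exists>\<theta> :: 'a \<Rightarrow> real. bounded_linear \<theta> \<and> (\<forall>x. \<bar>\<theta> x\<bar> \<le> norm x) \<and> \<theta> w = norm w"
    using norming_functional by metis
  then obtain \<theta> :: "'a \<Rightarrow> 'a \<Rightarrow> real" where
    \<theta>: "\<forall>w. bounded_linear (\<theta> w) \<and> (\<forall>x. \<bar>\<theta> w x\<bar> \<le> norm x) \<and> \<theta> w w = norm w"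
    by (rule exE[OF choice])
  have "\<delta> / 2 > 0" using assms(2) by simp
  then obtain F where F: "finite F" "W \<subseteq> (\<Union>f\<in>F. ball f (\<delta> / 2))"
    using assms(1) unfolding compact_eq_totally_bounded by blast
  have "\<exists>\<phi>\<in>\<theta> ` F. norm w - \<delta> \<le> \<phi> w" if w: "w \<in> W" for w
  proof -
    obtain f where f0: "f \<in> F" "w \<in> ball f (\<delta> / 2)" using F(2) w by auto
    then have f: "f \<in> F" "norm (w - f) < \<delta> / 2"
      by (auto simp: dist_norm norm_minus_commute)
    have "\<theta> f w = \<theta> f f + \<theta> f (w - f)"
      using \<theta> by (simp add: linear_diff[OF bounded_linear.linear])
    moreover have "\<bar>\<theta> f (w - f)\<bar> \<le> norm (w - f)" using \<theta> by blast
    moreover have "norm w \<le> norm f + norm (w - f)" by (rule norm_triangle_sub)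
    moreover have "\<theta> f f = norm f" using \<theta> by blast
    ultimately have "norm w - \<delta> \<le> \<theta> f w" using f(2) by linarith
    then show ?thesis using f(1) by blast
  qed
  then show ?thesis using F(1) \<theta> by (intro exI[of _ "\<theta> ` F"]) auto
qed

lemma bounded_linear_funpow: "bounded_linear (A ^^ n)" if "bounded_linear A"
  for A :: "'a::real_normed_vector \<Rightarrow> 'a"
proof (induction n)
  case 0
  show ?case by (simp add: id_def bounded_linear_ident)
next
  case (Suc n)
  show ?case using bounded_linear_compose[OF that Suc] by (simp add: comp_def)
qed

lemma funpow_approximate_eigenvector:
  fixes A :: "'a::complex_normed_vector \<Rightarrow> 'a"
  assumes A: "bounded_clinear A"
  shows "\<exists>L\<ge>0. \<forall>u. norm ((A ^^ n) u - \<mu> ^ n *\<^sub>C u) \<le> L * norm (A u - \<mu> *\<^sub>C u)"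
proof (induction n)
  case 0
  show ?case by (intro exI[of _ 0]) (simp add: scaleC_one)
next
  case (Suc n)
  then obtain L where L: "L \<ge> 0" "\<And>u. norm ((A ^^ n) u - \<mu> ^ n *\<^sub>C u) \<le> L * norm (A u - \<mu> *\<^sub>C u)" by blast
  have bl: "bounded_linear A" and sc: "\<And>c x. A (c *\<^sub>C x) = c *\<^sub>C A x"
    using A unfolding bounded_clinear_def by auto
  obtain K where K: "K > 0" "\<And>x. norm (A x) \<le> norm x * K"
    using bounded_linear.pos_bounded[OF bl] by auto
  have "norm ((A ^^ Suc n) u - \<mu> ^ Suc n *\<^sub>C u) \<le> (L * K + cmod \<mu> ^ n) * norm (A u - \<mu> *\<^sub>C u)" for u
  proof -
    have eq: "(A ^^ Suc n) u - \<mu> ^ Suc n *\<^sub>C u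
        = A ((A ^^ n) u - \<mu> ^ n *\<^sub>C u) + \<mu> ^ n *\<^sub>C (A u - \<mu> *\<^sub>C u)"
      by (simp add: linear_diff[OF bounded_linear.linear[OF bl]] sc scaleC_scaleC
          complex_vector.scale_right_diff_distrib mult.commute)
    have "norm (A ((A ^^ n) u - \<mu> ^ n *\<^sub>C u)) \<le> norm ((A ^^ n) u - \<mu> ^ n *\<^sub>C u) * K" by (rule K(2))
    also have "\<dots> \<le> L * norm (A u - \<mu> *\<^sub>C u) * K" using L(2) K(1) by simp
    finally have 1: "norm (A ((A ^^ n) u - \<mu> ^ n *\<^sub>C u)) \<le> L * norm (A u - \<mu> *\<^sub>C u) * K" .
    have "norm (\<mu> ^ n *\<^sub>C (A u - \<mu> *\<^sub>C u)) = cmod \<mu> ^ n * norm (A u - \<mu> *\<^sub>C u)"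
      by (simp add: norm_scaleC norm_power)
    with 1 show ?thesis unfolding eq
      using norm_triangle_ineq[of "A ((A ^^ n) u - \<mu> ^ n *\<^sub>C u)" "\<mu> ^ n *\<^sub>C (A u - \<mu> *\<^sub>C u)"]
      by (simp add: algebra_simps)
  qed
  moreover have "L * K + cmod \<mu> ^ n \<ge> 0" using L(1) K(1) by simp
  ultimately show ?case by blast
qed

lemma finite_positive_lower_bound:
  fixes g :: "'i \<Rightarrow> real"
  assumes "finite N" "\<And>n. n \<in> N \<Longrightarrow> g n > 0"
  obtains \<delta> where "\<delta> > 0" "\<And>n. n \<in> N \<Longrightarrow> \<delta> \<le> g n"
proof -
  have "Min (insert 1 (g ` N)) > 0" using assms by (subst Min_gr_iff) auto
  moreover have "Min (insert 1 (g ` N)) \<le> g n" if "n \<in> N" for n using assms(1) that by (intro Min_le) auto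
  ultimately show thesis using that by blast
qed

text \<open>
  From \<open>G\<^sub>n\<^sub>+\<^sub>1(x) = A (G\<^sub>n x) + K\<^sub>n\<^sub>+\<^sub>1(x\<^sub>n)\<close>: the first summand ranges over the image of a set with compact
  closure, and in the second one \<open>x\<^sub>n\<close> ranges over a bounded set.
\<close>

lemma iterates_compact_deviation:
  fixes A :: "'a::cbanach \<Rightarrow> 'a"
  assumes A: "bounded_linear A" and K: "\<And>n. 1 \<le> n \<Longrightarrow> compact_map (K n)" and S: "bounded S"
  shows "compact (closure ((\<lambda>x. iterates A K x n - (A ^^ n) x) ` S))"
proof (induction n)
  case 0
  have "(\<lambda>x. iterates A K x 0 - (A ^^ 0) x) ` S \<subseteq> {0}" by auto
  then have "closure ((\<lambda>x. iterates A K x 0 - (A ^^ 0) x) ` S) \<subseteq> {0}"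
    by (rule closure_minimal) simp
  then show ?case
    using compact_Int_closed[OF compact_sing closed_closure[of "(\<lambda>x. iterates A K x 0 - (A ^^ 0) x) ` S"], of 0]
    by (simp add: Int_absorb1)
next
  case (Suc n)
  let ?G = "\<lambda>n x. iterates A K x n - (A ^^ n) x"
  have lin: "linear A" using A by (rule bounded_linear.linear)
  have "bounded (?G n ` S)"
    using compact_imp_bounded[OF Suc] bounded_subset closure_subset by blast
  moreover have "bounded ((A ^^ n) ` S)"
    using bounded_linear_image[OF S bounded_linear_funpow[OF A]] .
  ultimately have "bounded ((\<lambda>x. ?G n x + (A ^^ n) x) ` S)" by (rule bounded_plus_comp)
  then have b: "bounded ((\<lambda>x. iterates A K x n) ` S)" by simp
  have "compact_map (K (Suc n))" by (rule K) simp
  then have c: "compact (closure (K (Suc n) ` (\<lambda>x. iterates A K x n) ` S))" (is "compact ?C")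
    using b unfolding compact_map_def by blast
  have "compact (A ` closure (?G n ` S))"
    using Suc by (rule compact_continuous_image[OF linear_continuous_on[OF A]])
  then have comp: "compact {x + y |x y. x \<in> A ` closure (?G n ` S) \<and> y \<in> ?C}"
    using c by (rule compact_sums)
  have "?G (Suc n) x \<in> {x + y |x y. x \<in> A ` closure (?G n ` S) \<and> y \<in> ?C}" if x: "x \<in> S" for x
  proof -
    have "?G (Suc n) x = A (?G n x) + K (Suc n) (iterates A K x n)"
      by (simp add: linear_diff[OF lin])
    moreover have "A (?G n x) \<in> A ` closure (?G n ` S)"
      using x by (intro imageI subsetD[OF closure_subset])
    moreover have "K (Suc n) (iterates A K x n) \<in> ?C"
      using x by (intro subsetD[OF closure_subset] imageI)
    ultimately show ?thesis by blast
  qed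
  then have "closure (?G (Suc n) ` S) \<subseteq> {x + y |x y. x \<in> A ` closure (?G n ` S) \<and> y \<in> ?C}"
    by (intro closure_minimal compact_imp_closed[OF comp]) blast
  then show ?case using compact_Int_closed[OF comp closed_closure[of "?G (Suc n) ` S"]]
    by (simp add: Int_absorb1)
qed

text \<open>
  The vector \<open>u\<close> handles the finitely many times in \<open>N\<close>. The functionals in \<open>\<Psi>\<close> carry the bounds
  of earlier blocks, which \<open>u\<close> must not disturb; those in \<open>\<Psi>'\<close> carry the new bounds, so that any later
  correction \<open>t\<close> with \<open>\<bar>\<psi> t\<bar> \<le> 1\<close> for all \<open>\<psi>\<close> in \<open>\<Psi>'\<close> is harmless.
\<close>

lemma block_step:
  fixes A :: "'a::cbanach \<Rightarrow> 'a" and C :: "nat \<Rightarrow> 'a set" and \<Psi> :: "('a \<Rightarrow> real) set"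
  assumes A: "bounded_clinear A" and \<mu>: "\<mu> \<in> op_spectrum (ess_lift A)"
    and max: "\<forall>\<nu>\<in>op_spectrum (ess_lift A). cmod \<nu> \<le> cmod \<mu>" and \<mu>0: "\<mu> \<noteq> 0"
    and N: "finite N" and C: "\<And>n. compact (C n)" and c: "c > 0"
    and a: "\<And>n. n \<in> N \<Longrightarrow> a n < c / 2"
    and \<Psi>: "finite \<Psi>" "\<forall>\<psi>\<in>\<Psi>. bounded_linear \<psi>" and \<eta>: "\<eta> > 0"
  shows "\<exists>u. \<exists>\<Psi>' :: ('a \<Rightarrow> real) set. norm u = 1 \<and> (\<forall>\<psi>\<in>\<Psi>. \<bar>\<psi> u\<bar> \<le> \<eta>) \<and> finite \<Psi>' \<and> (\<forall>\<psi>\<in>\<Psi>'. bounded_linear \<psi>) \<and>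
    (\<forall>n\<in>N. \<forall>f\<in>C n. \<forall>t. (\<forall>\<psi>\<in>\<Psi>'. \<bar>\<psi> t\<bar> \<le> 1) \<longrightarrow>
      a n * cmod \<mu> ^ n \<le> norm ((A ^^ n) (v + c *\<^sub>R u + t) + f))"
proof -
  have bl: "bounded_linear A" using A by (simp add: bounded_clinear_def)
  have blp: "bounded_linear (A ^^ n)" for n by (rule bounded_linear_funpow[OF bl])
  note lin = bounded_linear.linear[OF blp]
  \<comment> \<open>of the margin \<open>4 * \<delta>\<close>, half is spent on the choice of \<open>u\<close> and half is kept for later corrections\<close>
  obtain \<delta> where \<delta>: "\<delta> > 0" "\<And>n. n \<in> N \<Longrightarrow> \<delta> \<le> (c / 2 - a n) * cmod \<mu> ^ n / 4"
    using finite_positive_lower_bound[OF N, of "\<lambda>n. (c / 2 - a n) * cmod \<mu> ^ n / 4"] a \<mu>0 by auto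
  have "\<forall>n. \<exists>L. L \<ge> 0 \<and> (\<forall>u. norm ((A ^^ n) u - \<mu> ^ n *\<^sub>C u) \<le> L * norm (A u - \<mu> *\<^sub>C u))"
    using funpow_approximate_eigenvector[OF A] by blast
  then obtain L where L: "\<forall>n. L n \<ge> 0 \<and> (\<forall>u. norm ((A ^^ n) u - \<mu> ^ n *\<^sub>C u) \<le> L n * norm (A u - \<mu> *\<^sub>C u))"
    by (rule exE[OF choice])
  define W where "W x = (\<Union>n\<in>N. (\<lambda>f. (A ^^ n) x + f) ` C n)" for x
  have W: "compact (W x)" for x
    unfolding W_def using N C by (intro compact_UN compact_continuous_image continuous_intros) auto
  obtain \<Theta> :: "('a \<Rightarrow> real) set" where \<Theta>: "finite \<Theta>"
    "\<forall>\<theta>\<in>\<Theta>. bounded_linear \<theta> \<and> (\<forall>x. \<bar>\<theta> x\<bar> \<le> norm x)" "\<forall>w\<in>W v. \<exists>\<theta>\<in>\<Theta>. norm w - \<delta> \<le> \<theta> w"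
    using norming_functionals_compact[OF W[of v] \<delta>(1)] by blast
  \<comment> \<open>the three bounds serve the old constraints, the functionals in \<open>\<Theta>\<close>, and the passage from \<open>\<mu> ^ n\<close> to \<open>A ^^ n\<close>\<close>
  define \<epsilon> where "\<epsilon> = Min {\<eta>, \<delta> / c, \<delta> / (c * (1 + sum L N))}"
  have S0: "0 \<le> sum L N" using L by (intro sum_nonneg) auto
  have \<epsilon>: "\<epsilon> > 0" "\<epsilon> \<le> \<eta>" "\<epsilon> \<le> \<delta> / c" "\<epsilon> \<le> \<delta> / (c * (1 + sum L N))"
    using \<eta> \<delta>(1) c S0 by (auto simp: \<epsilon>_def intro!: divide_pos_pos mult_pos_pos)
  \<comment> \<open>the functionals are only real-linear, so the scalars \<open>\<mu> ^ n\<close> have to be built in\<close>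
  define \<Phi> where "\<Phi> = \<Psi> \<union> (\<lambda>(\<theta>, n) x. \<theta> (\<mu> ^ n *\<^sub>C x)) ` (\<Theta> \<times> N)"
  have \<Phi>: "finite \<Phi>" "\<forall>\<phi>\<in>\<Phi>. bounded_linear \<phi>"
    unfolding \<Phi>_def using \<Psi> \<Theta>(1,2) N by (auto intro!: bounded_linear_compose[OF _ bounded_linear_scaleC])
  obtain u where u: "norm u = 1" "norm (A u - \<mu> *\<^sub>C u) \<le> \<epsilon>" "\<forall>\<phi>\<in>\<Phi>. \<bar>\<phi> u\<bar> \<le> \<epsilon>"
    using weakly_small_approximate_eigenvector[OF A \<mu> max \<Phi> \<epsilon>(1)] by blast
  have lower: "a n * cmod \<mu> ^ n + 2 * \<delta> \<le> norm ((A ^^ n) (v + c *\<^sub>R u) + f)" if n: "n \<in> N" and f: "f \<in> C n" for n f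
  proof -
    define w where "w = (A ^^ n) v + f"
    define z where "z = w + c *\<^sub>R (\<mu> ^ n *\<^sub>C u)"
    have "w \<in> W v" unfolding W_def w_def using n f by blast
    then obtain \<theta> where \<theta>: "\<theta> \<in> \<Theta>" "norm w - \<delta> \<le> \<theta> w" using \<Theta>(3) by blast
    have \<theta>bl: "bounded_linear \<theta>" "\<bar>\<theta> z\<bar> \<le> norm z" using \<Theta>(2) \<theta>(1) by auto
    have "(\<lambda>x. \<theta> (\<mu> ^ n *\<^sub>C x)) \<in> \<Phi>" unfolding \<Phi>_def using \<theta>(1) n by force
    from bspec[OF u(3) this] have \<theta>u: "\<bar>\<theta> (\<mu> ^ n *\<^sub>C u)\<bar> \<le> \<epsilon>" .
    have c\<epsilon>: "c * \<epsilon> \<le> \<delta>" using \<epsilon>(3) c by (simp add: field_simps)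
    have "\<theta> z = \<theta> w + c * \<theta> (\<mu> ^ n *\<^sub>C u)"
      unfolding z_def using \<theta>bl(1) by (simp add: linear_add[OF bounded_linear.linear] linear_scale[OF bounded_linear.linear])
    moreover have "- (c * \<epsilon>) \<le> c * \<theta> (\<mu> ^ n *\<^sub>C u)"
      using mult_left_mono[of "- \<epsilon>" "\<theta> (\<mu> ^ n *\<^sub>C u)" c] \<theta>u c by simp
    ultimately have 1: "norm w - 2 * \<delta> \<le> norm z"
      using \<theta>(2) \<theta>bl(2) c\<epsilon> by linarith
    have "norm (c *\<^sub>R (\<mu> ^ n *\<^sub>C u)) = c * cmod \<mu> ^ n"
      using c u(1) by (simp add: norm_scaleC norm_power)
    then have 2: "c * cmod \<mu> ^ n - norm w \<le> norm z"
      using norm_diff_ineq[of "c *\<^sub>R (\<mu> ^ n *\<^sub>C u)" w] by (simp add: z_def add.commute)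
    have eq: "(A ^^ n) (v + c *\<^sub>R u) + f = z + c *\<^sub>R ((A ^^ n) u - \<mu> ^ n *\<^sub>C u)"
      by (simp add: z_def w_def linear_add[OF lin] linear_scale[OF lin] scaleR_diff_right)
    have "norm ((A ^^ n) u - \<mu> ^ n *\<^sub>C u) \<le> L n * \<epsilon>"
      using L u(2) by (meson mult_left_mono order_trans)
    also have "\<dots> \<le> (1 + sum L N) * \<epsilon>"
      using member_le_sum[OF n, of L] L N \<epsilon>(1) by (intro mult_right_mono) auto
    finally have "c * norm ((A ^^ n) u - \<mu> ^ n *\<^sub>C u) \<le> c * ((1 + sum L N) * \<epsilon>)" using c by simp
    also have "\<dots> \<le> \<delta>"
    proof -
      have "0 < c * (1 + sum L N)" using c S0 by (intro mult_pos_pos) auto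
      then have "\<epsilon> * (c * (1 + sum L N)) \<le> \<delta>" using \<epsilon>(4) pos_le_divide_eq by blast
      then show ?thesis by (simp only: mult_ac)
    qed
    finally have "norm (c *\<^sub>R ((A ^^ n) u - \<mu> ^ n *\<^sub>C u)) \<le> \<delta>" using c by simp
    then have 3: "norm z - \<delta> \<le> norm ((A ^^ n) (v + c *\<^sub>R u) + f)"
      unfolding eq using norm_diff_ineq[of z "c *\<^sub>R ((A ^^ n) u - \<mu> ^ n *\<^sub>C u)"] by linarith
    have "(c / 2) * cmod \<mu> ^ n - a n * cmod \<mu> ^ n \<ge> 4 * \<delta>"
      using \<delta>(2)[OF n] by (simp add: left_diff_distrib)
    then show ?thesis using 1 2 3 by linarith
  qed
  obtain \<Theta>' :: "('a \<Rightarrow> real) set" where \<Theta>': "finite \<Theta>'"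
    "\<forall>\<theta>\<in>\<Theta>'. bounded_linear \<theta> \<and> (\<forall>x. \<bar>\<theta> x\<bar> \<le> norm x)"
    "\<forall>w\<in>W (v + c *\<^sub>R u). \<exists>\<theta>\<in>\<Theta>'. norm w - \<delta> \<le> \<theta> w"
    using norming_functionals_compact[OF W[of "v + c *\<^sub>R u"] \<delta>(1)] by blast
  \<comment> \<open>dividing by \<open>\<delta>\<close> normalises the tolerance of later corrections to \<open>1\<close>\<close>
  define \<Psi>' where "\<Psi>' = (\<lambda>(\<theta>, n) x. \<theta> ((A ^^ n) x) / \<delta>) ` (\<Theta>' \<times> N)"
  have fin: "finite \<Psi>'" unfolding \<Psi>'_def using \<Theta>'(1) N by blast
  have bl': "\<forall>\<psi>\<in>\<Psi>'. bounded_linear \<psi>"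
    unfolding \<Psi>'_def using \<Theta>'(2)
    by (auto intro!: bounded_linear_compose[OF bounded_linear_divide] bounded_linear_compose[OF _ blp])
  have "a n * cmod \<mu> ^ n \<le> norm ((A ^^ n) (v + c *\<^sub>R u + t) + f)"
    if n: "n \<in> N" and f: "f \<in> C n" and t: "\<forall>\<psi>\<in>\<Psi>'. \<bar>\<psi> t\<bar> \<le> 1" for n f t
  proof -
    define w where "w = (A ^^ n) (v + c *\<^sub>R u) + f"
    have "w \<in> W (v + c *\<^sub>R u)" unfolding W_def w_def using n f by blast
    then obtain \<theta> where \<theta>: "\<theta> \<in> \<Theta>'" "norm w - \<delta> \<le> \<theta> w" using \<Theta>'(3) by blast
    have \<theta>bl: "bounded_linear \<theta>" "\<bar>\<theta> (w + (A ^^ n) t)\<bar> \<le> norm (w + (A ^^ n) t)" using \<Theta>'(2) \<theta>(1) by auto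
    have "(\<lambda>x. \<theta> ((A ^^ n) x) / \<delta>) \<in> \<Psi>'" unfolding \<Psi>'_def using \<theta>(1) n by force
    from bspec[OF t this] have "\<bar>\<theta> ((A ^^ n) t) / \<delta>\<bar> \<le> 1" .
    then have "\<bar>\<theta> ((A ^^ n) t)\<bar> \<le> \<delta>" using \<delta>(1) by simp
    then have t': "norm w - 2 * \<delta> \<le> norm (w + (A ^^ n) t)"
      using \<theta>(2) \<theta>bl(2) linear_add[OF bounded_linear.linear[OF \<theta>bl(1)], of w "(A ^^ n) t"] by linarith
    have eq: "(A ^^ n) (v + c *\<^sub>R u + t) + f = w + (A ^^ n) t"
      by (simp only: w_def linear_add[OF lin] ac_simps)
    have "a n * cmod \<mu> ^ n + 2 * \<delta> \<le> norm w" unfolding w_def by (rule lower[OF n f])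
    with t' show ?thesis unfolding eq by linarith
  qed
  moreover have "\<bar>\<psi> u\<bar> \<le> \<eta>" if "\<psi> \<in> \<Psi>" for \<psi>
  proof -
    have "\<psi> \<in> \<Phi>" using that by (simp add: \<Phi>_def)
    then have "\<bar>\<psi> u\<bar> \<le> \<epsilon>" using u(3) by blast
    then show ?thesis using \<epsilon>(2) by linarith
  qed
  ultimately show ?thesis using u(1) fin bl'
    by (intro exI[of _ u] exI[of _ \<Psi>'] conjI ballI allI impI) simp_all
qed

text \<open>
  The functionals of all earlier steps take values of modulus at most \<open>(1/2)^(k + 1)\<close> at \<open>c\<^sub>k u\<^sub>k\<close>. Hence those
  of any one step are bounded by \<open>1\<close> at the sum of all later corrections, as \<open>block_step\<close> requires.
\<close>

lemma block_sequence:
  fixes A :: "'a::cbanach \<Rightarrow> 'a" and C :: "nat \<Rightarrow> 'a set" and a c :: "nat \<Rightarrow> real" and N :: "nat \<Rightarrow> nat set"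
  assumes A: "bounded_clinear A" and \<mu>: "\<mu> \<in> op_spectrum (ess_lift A)"
    and max: "\<forall>\<nu>\<in>op_spectrum (ess_lift A). cmod \<nu> \<le> cmod \<mu>" and \<mu>0: "\<mu> \<noteq> 0"
    and N: "\<And>k. finite (N k)" and C: "\<And>n. compact (C n)" and c: "\<And>k. c k > 0" "summable c"
    and a: "\<And>k n. n \<in> N k \<Longrightarrow> a n < c k / 2"
  obtains u where "\<And>k. norm (u k) = 1"
    "\<And>k n f. n \<in> N k \<Longrightarrow> f \<in> C n \<Longrightarrow> a n * cmod \<mu> ^ n \<le> norm ((A ^^ n) (y + (\<Sum>k. c k *\<^sub>R u k)) + f)"
proof -
  \<comment> \<open>the pair \<open>p\<close> of a vector and a set of functionals is an admissible \<open>k\<close>-th step after the steps \<open>g j\<close> with \<open>j < k\<close>\<close>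
  define P where "P g k p \<longleftrightarrow> norm (fst p) = 1 \<and>
      (\<forall>j<k. \<forall>\<psi>\<in>snd (g j). \<bar>\<psi> (fst p)\<bar> \<le> (1/2)^Suc k / c k) \<and>
      finite (snd p) \<and> (\<forall>\<psi>\<in>snd p. bounded_linear \<psi>) \<and>
      (\<forall>n\<in>N k. \<forall>f\<in>C n. \<forall>t. (\<forall>\<psi>\<in>snd p. \<bar>\<psi> t\<bar> \<le> 1) \<longrightarrow>
        a n * cmod \<mu> ^ n \<le> norm ((A ^^ n) ((y + (\<Sum>j<k. c j *\<^sub>R fst (g j))) + c k *\<^sub>R fst p + t) + f))"
    for g :: "nat \<Rightarrow> 'a \<times> ('a \<Rightarrow> real) set" and k and p :: "'a \<times> ('a \<Rightarrow> real) set"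
  have "\<exists>g. \<forall>k. P g k (g k)"
  proof (rule dependent_wellorder_choice)
    show "P f k p = P g k p" if "\<And>j. j < k \<Longrightarrow> f j = g j" for p f g k
      using that by (simp add: P_def)
    show "\<exists>p. P g k p" if prev: "\<And>j. j < k \<Longrightarrow> P g j (g j)" for k g
    proof -
      let ?\<Psi> = "\<Union>j<k. snd (g j)"
      have "finite (snd (g j)) \<and> (\<forall>\<psi>\<in>snd (g j). bounded_linear \<psi>)" if "j < k" for j
        using prev[OF that] by (simp add: P_def)
      then have \<Psi>: "finite ?\<Psi>" "\<forall>\<psi>\<in>?\<Psi>. bounded_linear \<psi>" by auto
      have "(1/2 :: real)^Suc k / c k > 0" using c(1) by simp
      from block_step[where a=a and C=C and N="N k" and v="y + (\<Sum>j<k. c j *\<^sub>R fst (g j))",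
          OF A \<mu> max \<mu>0 N[of k] C c(1)[of k] a \<Psi> this]
      obtain u and \<Psi>' :: "('a \<Rightarrow> real) set" where "norm u = 1" "\<forall>\<psi>\<in>?\<Psi>. \<bar>\<psi> u\<bar> \<le> (1/2)^Suc k / c k" "finite \<Psi>'"
        "\<forall>\<psi>\<in>\<Psi>'. bounded_linear \<psi>"
        "\<forall>n\<in>N k. \<forall>f\<in>C n. \<forall>t. (\<forall>\<psi>\<in>\<Psi>'. \<bar>\<psi> t\<bar> \<le> 1) \<longrightarrow>
          a n * cmod \<mu> ^ n \<le> norm ((A ^^ n) ((y + (\<Sum>j<k. c j *\<^sub>R fst (g j))) + c k *\<^sub>R u + t) + f)"
        by blast
      then have "P g k (u, \<Psi>')" unfolding P_def fst_conv snd_conv by blast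
      then show ?thesis by (rule exI)
    qed
  qed
  then obtain g where g': "\<forall>k. P g k (g k)" by (rule exE)
  have g: "norm (fst (g k)) = 1"
    "\<And>j \<psi>. j < k \<Longrightarrow> \<psi> \<in> snd (g j) \<Longrightarrow> \<bar>\<psi> (fst (g k))\<bar> \<le> (1/2)^Suc k / c k"
    "\<And>\<psi>. \<psi> \<in> snd (g k) \<Longrightarrow> bounded_linear \<psi>"
    "\<And>n f t. n \<in> N k \<Longrightarrow> f \<in> C n \<Longrightarrow> (\<And>\<psi>. \<psi> \<in> snd (g k) \<Longrightarrow> \<bar>\<psi> t\<bar> \<le> 1) \<Longrightarrow>
      a n * cmod \<mu> ^ n \<le> norm ((A ^^ n) ((y + (\<Sum>j<k. c j *\<^sub>R fst (g j))) + c k *\<^sub>R fst (g k) + t) + f)" for k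
    using g'[rule_format, of k] unfolding P_def by blast+
  define u where "u k = fst (g k)" for k
  have u1: "norm (u k) = 1" for k using g(1) by (simp add: u_def)
  have summ: "summable (\<lambda>k. c k *\<^sub>R u k)"
    using c u1 by (intro summable_comparison_test[OF _ c(2)] exI[of _ 0]) (simp add: less_imp_le)
  have "a n * cmod \<mu> ^ n \<le> norm ((A ^^ n) (y + (\<Sum>k. c k *\<^sub>R u k)) + f)"
    if n: "n \<in> N k" and f: "f \<in> C n" for k n f
  proof -
    define t where "t = (\<Sum>i. c (i + Suc k) *\<^sub>R u (i + Suc k))"
    have summ_tail: "summable (\<lambda>i. c (i + Suc k) *\<^sub>R u (i + Suc k))"
      by (rule summable_ignore_initial_segment[OF summ])
    have split: "y + (\<Sum>k. c k *\<^sub>R u k) = (y + (\<Sum>j<k. c j *\<^sub>R u j)) + c k *\<^sub>R u k + t"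
      using suminf_split_initial_segment[OF summ, of "Suc k"] by (simp add: t_def algebra_simps)
    have "\<bar>\<psi> t\<bar> \<le> 1" if \<psi>: "\<psi> \<in> snd (g k)" for \<psi>
    proof -
      have bl: "bounded_linear \<psi>" by (rule g(3)[OF \<psi>])
      have sums1: "(\<lambda>i. (1/2 :: real) ^ Suc i) sums 1" by (rule power_half_series)
      have "norm (\<psi> (c (i + Suc k) *\<^sub>R u (i + Suc k))) \<le> (1/2) ^ Suc i" for i
      proof -
        have "\<bar>\<psi> (u (i + Suc k))\<bar> \<le> (1/2)^Suc (i + Suc k) / c (i + Suc k)"
          unfolding u_def by (rule g(2)[OF _ \<psi>]) simp
        then have "c (i + Suc k) * \<bar>\<psi> (u (i + Suc k))\<bar> \<le> (1/2)^Suc (i + Suc k)"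
          using c(1)[of "i + Suc k"] by (simp add: field_simps)
        also have "\<dots> \<le> (1/2) ^ Suc i" by (intro power_decreasing) auto
        finally show ?thesis
          using c(1)[of "i + Suc k"] by (simp add: linear_scale[OF bounded_linear.linear[OF bl]] abs_mult)
      qed
      then have "norm (\<Sum>i. \<psi> (c (i + Suc k) *\<^sub>R u (i + Suc k))) \<le> (\<Sum>i. (1/2) ^ Suc i)"
        by (intro norm_suminf_le sums_summable[OF sums1])
      moreover have "\<psi> t = (\<Sum>i. \<psi> (c (i + Suc k) *\<^sub>R u (i + Suc k)))"
        unfolding t_def by (rule bounded_linear.suminf[OF bl summ_tail])
      ultimately show ?thesis using sums_unique[OF sums1] by simp
    qed
    then show ?thesis
      unfolding split unfolding u_def by (intro g(4) n f)
  qed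
  then show thesis using that u1 by blast
qed

theorem theorem1p2:
  fixes A :: "'a::cbanach \<Rightarrow> 'a"
    and K :: "nat \<Rightarrow> 'a \<Rightarrow> 'a"
    and a :: "nat \<Rightarrow> real"
    and y :: 'a
    and r :: real
    and n0 :: nat
  assumes "\<not> finite_cdim (UNIV :: 'a set)"
    and "bounded_clinear A"
    and "\<And>n. 1 \<le> n \<Longrightarrow> compact_map (K n)"
    and "\<And>n. 1 \<le> n \<Longrightarrow> 0 \<le> a n"
    and "\<And>m n. 1 \<le> m \<Longrightarrow> m \<le> n \<Longrightarrow> a n \<le> a m"
    and "a \<longlonglongrightarrow> 0"
    and "0 < r"
    and "1 \<le> n0"
    and "a n0 < r / 2"
  shows "\<exists>x0 \<in> ball y r. \<forall>n\<ge>n0. norm (iterates A K x0 n) \<ge> a n * essential_spectral_radius A ^ n"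
proof -
  obtain \<mu> where \<mu>: "cmod \<mu> = essential_spectral_radius A" "\<mu> \<in> op_spectrum (ess_lift A)"
    "\<forall>\<nu>\<in>op_spectrum (ess_lift A). cmod \<nu> \<le> cmod \<mu>"
    using essential_spectral_radius_attained[OF assms(1,2)] by blast
  show ?thesis
  proof (cases "\<mu> = 0")
    case True
    then have "essential_spectral_radius A = 0" using \<mu>(1) by simp
    then have "a n * essential_spectral_radius A ^ n \<le> norm (iterates A K y n)" if "n \<ge> n0" for n
      using that assms(8) by (cases n) simp_all
    then show ?thesis using assms(7) by (intro bexI[of _ y]) auto
  next
    case False
    define d where "d = (r - 2 * a n0) / 2"
    have d: "d > 0" using assms(9) by (simp add: d_def)
    \<comment> \<open>\<open>c 0\<close> exceeds \<open>2 * a n0\<close>, and all \<open>c k\<close> are positive with sum less than \<open>r\<close>\<close>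
    define c where "c k = (if k = 0 then 2 * a n0 else 0) + d / 2 * (1/2)^k" for k :: nat
    have a0: "a n0 \<ge> 0" using assms(4,8) by simp
    have cpos: "c k > 0" for k using d a0 by (simp add: c_def add_nonneg_pos)
    have "c sums (2 * a n0 + d / 2 * (1 / (1 - 1/2)))"
      unfolding c_def by (intro sums_add sums_mult geometric_sums) (auto intro: sums_single)
    then have csums: "c sums (2 * a n0 + d)" by simp
    have "2 * a n0 + d < r" using d by (simp add: d_def field_simps)
    \<comment> \<open>the \<open>k\<close>-th block starts at \<open>\<nu> k\<close>, a time from which on \<open>a\<close> stays below \<open>c k / 2\<close>\<close>
    have "\<exists>\<nu>. \<forall>k. (a (\<nu> k) < c k / 2 \<and> (k = 0 \<longrightarrow> \<nu> k = n0)) \<and> \<nu> k < \<nu> (Suc k)"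
    proof (rule dependent_nat_choice)
      show "\<exists>n. a n < c 0 / 2 \<and> (0 = (0::nat) \<longrightarrow> n = n0)"
        using d by (intro exI[of _ n0]) (simp add: c_def)
      fix n k
      have "\<forall>\<^sub>F m in sequentially. a m < c (Suc k) / 2"
        using assms(6) cpos[of "Suc k"] by (intro order_tendstoD(2)[OF assms(6)]) simp
      then obtain M where M: "\<And>m. m \<ge> M \<Longrightarrow> a m < c (Suc k) / 2"
        unfolding eventually_sequentially by blast
      show "\<exists>m. (a m < c (Suc k) / 2 \<and> (Suc k = 0 \<longrightarrow> m = n0)) \<and> n < m"
        using M[of "max M (Suc n)"] by (intro exI[of _ "max M (Suc n)"]) auto
    qed
    then obtain \<nu> where \<nu>: "\<forall>k. (a (\<nu> k) < c k / 2 \<and> (k = 0 \<longrightarrow> \<nu> k = n0)) \<and> \<nu> k < \<nu> (Suc k)"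
      by (rule exE)
    have \<nu>0: "\<nu> 0 = n0" using \<nu> by blast
    have mono: "strict_mono \<nu>" using \<nu> by (simp add: strict_mono_Suc_iff)
    have \<nu>n0: "n0 \<le> \<nu> k" for k using strict_mono_less_eq[OF mono, of 0 k] \<nu>0 by simp
    define C where "C n = closure ((\<lambda>x. iterates A K x n - (A ^^ n) x) ` ball y r)" for n
    have bl: "bounded_linear A" using assms(2) by (simp add: bounded_clinear_def)
    have C: "compact (C n)" for n
      unfolding C_def by (rule iterates_compact_deviation[OF bl assms(3) bounded_ball])
    have ac: "a n < c k / 2" if "n \<in> {\<nu> k..<\<nu> (Suc k)}" for n k
    proof -
      have "a n \<le> a (\<nu> k)" using that \<nu>n0[of k] assms(8) by (intro assms(5)) auto
      then show ?thesis using \<nu> by (meson le_less_trans)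
    qed
    obtain u where u: "\<And>k. norm (u k) = 1"
      "\<And>k n f. n \<in> {\<nu> k..<\<nu> (Suc k)} \<Longrightarrow> f \<in> C n \<Longrightarrow>
        a n * cmod \<mu> ^ n \<le> norm ((A ^^ n) (y + (\<Sum>k. c k *\<^sub>R u k)) + f)"
      using block_sequence[where N="\<lambda>k. {\<nu> k..<\<nu> (Suc k)}" and y=y and a=a and c=c and C=C,
          OF assms(2) \<mu>(2,3) False _ C cpos sums_summable[OF csums] ac] by blast
    define x0 where "x0 = y + (\<Sum>k. c k *\<^sub>R u k)"
    have "norm (\<Sum>k. c k *\<^sub>R u k) \<le> (\<Sum>k. c k)"
      using u(1) cpos by (intro norm_suminf_le sums_summable[OF csums]) (simp add: less_imp_le)
    then have x0: "x0 \<in> ball y r"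
      using sums_unique[OF csums] \<open>2 * a n0 + d < r\<close> by (simp add: x0_def dist_norm)
    have "a n * essential_spectral_radius A ^ n \<le> norm (iterates A K x0 n)" if n: "n \<ge> n0" for n
    proof -
      \<comment> \<open>the block that contains \<open>n\<close>\<close>
    define k where "k = (LEAST k. n < \<nu> (Suc k))"
      have "n < \<nu> (Suc n)" using strict_mono_imp_increasing[OF mono, of "Suc n"] by simp
      then have k1: "n < \<nu> (Suc k)" unfolding k_def by (rule LeastI)
      have k2: "\<nu> k \<le> n"
      proof (cases k)
        case 0
        then show ?thesis using n \<nu>0 by simp
      next
        case (Suc j)
        then have "\<not> n < \<nu> (Suc j)" using not_less_Least[of j "\<lambda>k. n < \<nu> (Suc k)"] unfolding k_def by simp
        then show ?thesis using Suc by simp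
      qed
      have "iterates A K x0 n - (A ^^ n) x0 \<in> C n"
        unfolding C_def using x0 by (intro subsetD[OF closure_subset] imageI)
      then have "a n * cmod \<mu> ^ n \<le> norm ((A ^^ n) (y + (\<Sum>k. c k *\<^sub>R u k)) + (iterates A K x0 n - (A ^^ n) x0))"
        using k1 k2 by (intro u(2)[of n k]) auto
      then show ?thesis by (simp add: x0_def \<mu>(1))
    qed
    then show ?thesis using x0 by blast
  qed
qed

end
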